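(* Let $\mathscr T=(V,E)$ be a rooted directed tree with root $\mathsf{root}$ and let $\mathscr T_\infty$ be the extended directed tree associated with $\mathscr T$, with vertex set $V_\infty=V\sqcup\{\infty\}$. For $u\in V$ and $b\in V\setminus\{u\}$, consider a weight system $\lambda_u=\{\lambda_{uv}\}_{v\in V_\infty}$ of complex numbers and let $W=W^{(b)}_{\lambda_u}$ be the weighted join operator on $\mathscr T$. With $U$, $\mathscr H=\ell^2(U)$, $A_u$, $e_{\lambda_u,A_u}$ as in the context and $W_\mu=\{w\in U:\lambda_{uw}=\mu\}$ for $\mu\in\mathbb C$, the following hold: (i) $\sigma_p(W)=\{\lambda_{uv}:v\in\mathsf{Asc}(u)\cup\mathsf{Des}_b[u]\}\cup\{0\}$ if $b\in\mathsf{Des}_u(u)$, and $\sigma_p(W)=\{\lambda_{uv}:v\in\mathsf{Des}(u)\}\cup\{0\}$ otherwise. (ii) The spectrum $\sigma(W)$ is the topological closure of $\sigma_p(W)$. (iii) If $\mathscr E_W(\mu)$ denotes the eigenspace corresponding to the eigenvalue $\mu$ of $W$, then $$\mathscr E_W(\mu)=\begin{cases}\ell^2(W_\mu)&\text{if }\mu\ne0,\ \mu\neq\lambda_{uu},\\ \ell^2(W_\mu)\oplus[e_u]&\text{if }\mu\neq0,\ \mu=\lambda_{uu},\\ \ell^2(W_0)\oplus\big((\ell^2(V)\ominus\mathscr H)\ominus[e_{\lambda_u,A_u}]\big)&\text{if }\mu=0.\end{cases}$$ (iv) The multiplicity function $\mathfrak m_W:\sigma_p(W)\to\mathbb Z_+\cup\{\aleph_0\}$,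 $\mathfrak m_W(\mu)=\dim\mathscr E_W(\mu)$, is given by $\mathfrak m_W(\mu)=\mathrm{card}\{v\in\{u\}\cup U:\lambda_{uv}=\mu\}$ if $\mu\neq0$. In addition, if $\mathscr T$ is leafless and if there exists a branching vertex $w\in\mathsf{Asc}(u)$, then $\mathfrak m_W(0)=\aleph_0$. (v) The rootspace $\mathscr R_W(\mu)$ of $W$ corresponding to the generalized eigenvalue $\mu$ is given by $$\mathscr R_W(\mu)=\begin{cases}\mathscr E_W(\mu)&\text{if }\mu\in\sigma_p(W)\setminus\{0\},\\ \mathscr E_W(0)&\text{if }\mu=0,\ \lambda_{uu}\neq0,\\ \mathscr E_W(0)\oplus[e_{\lambda_u,A_u}]&\text{if }\mu=0,\ \lambda_{uu}=0.\end{cases}$$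
   Context: Trees. A directed tree $\mathscr T=(V,E)$ is a directed graph (no loops, $V$ and $E$ nonempty) which has no circuits, is connected (ignoring orientation), and in which every non-root vertex $v$ has exactly one parent $\mathsf{par}(v)$; it is rooted if there is a unique vertex $\mathsf{root}$ without parent. Throughout $\mathrm{card}(V)=\aleph_0$. Leafless: every vertex has at least one child; branching vertex: vertex with at least two children. $\mathsf{Des}(u)\subseteq V$ is the set of descendants of $u$, including $u$; $\mathsf{Asc}(u)=\{\mathsf{par}^{\langle n\rangle}(u):n\ge1\}$. Depth is the length of the directed path from $\mathsf{root}$. For $v\in\mathsf{Des}(u)$, $[u,v]$ is the set of vertices of the directed path from $u$ to $v$, $(u,v]=[u,v]\setminus\{u\}$, $\mathsf{Des}_v(u)=\mathsf{Des}(u)\setminus[u,v]$, $\mathsf{Des}_v[u]=\mathsf{Des}(u)\setminus(u,v]$; so $\mathsf{Des}_u(u)=\mathsf{Des}(u)\setminus\{u\}$. Join operations. The extended tree has vertex set $V_\infty=V\sqcup\{\infty\}$ with $\infty$ declared a child (hence a descendant) of every $v\in V$. For $u,v\in V_\infty$: $u\sqcup v=u$ if $u$ is a descendant of $v$; $=v$ if $v$ is a descendant of $u$; $=\infty$ otherwise. For $u,v\in V$, $u\sqcap v$ is the vertex of largest depth among $\{w\in V:\mathsf{par}^{\langle n\rangle}(u)=w=\mathsf{par}^{\langle m\rangle}(v)\text{ for some }m,n\ge0\}$. For $b\in V$: $u\sqcup_bv=u\sqcap v$ if $u,v\in\mathsf{Asc}(b)$; $=u$ if $v=b$; $=v$ if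 $u=b$; $=u\sqcup v$ otherwise. Operators. A weight system is a family $\{\lambda_{uv}\}_{v\in V_\infty}\subseteq\mathbb C$ with $\lambda_{u\infty}=0$. $W^{(b)}_{\lambda_u}$ has domain $\{f\in\ell^2(V):\Lambda^{(b)}_uf\in\ell^2(V)\}$ and $W^{(b)}_{\lambda_u}f=\Lambda^{(b)}_uf$, where $(\Lambda^{(b)}_uf)(w)=\sum_{v\in V:\,u\sqcup_bv=w}\lambda_{uv}f(v)$. Put $U=\mathsf{Asc}(u)\cup\mathsf{Des}_b(u)$ and $A_u=[u,b]$ if $b\in\mathsf{Des}(u)$; $U=\mathsf{Des}_u(u)$ and $A_u=\mathsf{Asc}(u)\cup\{b,u\}$ otherwise; $\mathscr H=\ell^2(U)\subseteq\ell^2(V)$; $e_{\lambda_u,A_u}=\sum_{v\in A_u}\overline{\lambda_{uv}}e_v$. (One has $W^{(b)}_{\lambda_u}=D\oplus N$ on $\mathscr H\oplus(\ell^2(V)\ominus\mathscr H)$ with $D$ the diagonal operator $e_v\mapsto\lambda_{uv}e_v$ and $N=\langle\cdot,e_{\lambda_u,A_u}\rangle e_u$.) $[x]$ is the linear span of $x$. A complex number $\mu$ is a generalized eigenvalue of $T$ if there are a positive integer $k$ and a non-zero $f\in\mathscr D(T^k)$ (a generalized eigenvector) with $(T-\mu)^kf=0$; the rootspace $\mathscr R_T(\mu)$ is the closed span of the generalized eigenvectors corresponding to $\mu$. $\sigma(T)$ is the complement of the set of $\lambda$ such that $(T-\lambda)^{-1}$ exists as a bounded operator on the whole space; $\sigma_p(T)$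 is the set of eigenvalues. *)

theory Defs
  imports "HOL-Analysis.Analysis" "HOL-Library.Function_Algebras"
begin

unbundle cardinal_syntax

section \<open>Directed trees\<close>

text \<open>An edge \<open>(u, v)\<close> points from the parent \<open>u\<close> to the child \<open>v\<close>. Acyclicity excludes both
  loops and circuits; connectedness ignores the orientation of the edges.\<close>

locale directed_tree =
  fixes V :: "'v set" and E :: "('v \<times> 'v) set"
  assumes verts_nonempty: "V \<noteq> {}"
    and edges_nonempty: "E \<noteq> {}"
    and edges_in_verts: "E \<subseteq> V \<times> V"
    and no_circuits: "acyclic E"
    and connected_undirected: "\<lbrakk>u \<in> V; v \<in> V\<rbrakk> \<Longrightarrow> (u, v) \<in> (E \<union> E\<inverse>)\<^sup>*"
    and parent_unique: "\<lbrakk>(u, v) \<in> E; (u', v) \<in> E\<rbrakk> \<Longrightarrow> u = u'"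

locale rooted_directed_tree = directed_tree V E
  for V :: "'v set" and E :: "('v \<times> 'v) set" +
  fixes rt :: 'v
  assumes unique_root: "{v \<in> V. \<forall>u. (u, v) \<notin> E} = {rt}"

definition leafless :: "'v set \<Rightarrow> ('v \<times> 'v) set \<Rightarrow> bool" where
  "leafless V E \<longleftrightarrow> (\<forall>v\<in>V. \<exists>w. (v, w) \<in> E)"

definition branching_vertex :: "('v \<times> 'v) set \<Rightarrow> 'v \<Rightarrow> bool" where
  "branching_vertex E v \<longleftrightarrow> (\<exists>w w'. w \<noteq> w' \<and> (v, w) \<in> E \<and> (v, w') \<in> E)"

definition Des :: "('v \<times> 'v) set \<Rightarrow> 'v \<Rightarrow> 'v set" where
  "Des E u = {v. (u, v) \<in> E\<^sup>*}"

text \<open>The relation \<open>(w, u) \<in> E ^^ n\<close> is the graph of the partial function \<open>par\<close> iterated \<open>n\<close>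
  times: it says that the \<open>n\<close>-th parent of \<open>u\<close> exists and equals \<open>w\<close>.\<close>

definition Asc :: "('v \<times> 'v) set \<Rightarrow> 'v \<Rightarrow> 'v set" where
  "Asc E u = {w. \<exists>n\<ge>1. (w, u) \<in> E ^^ n}"

definition depth :: "('v \<times> 'v) set \<Rightarrow> 'v \<Rightarrow> 'v \<Rightarrow> nat" where
  "depth E rt v = (THE n. (rt, v) \<in> E ^^ n)"

text \<open>For \<open>v \<in> Des E u\<close> these are the sets \<open>[u, v]\<close>, \<open>(u, v]\<close>, \<open>Des\<^sub>v(u)\<close> and \<open>Des\<^sub>v[u]\<close>.\<close>

definition path_cc :: "('v \<times> 'v) set \<Rightarrow> 'v \<Rightarrow> 'v \<Rightarrow> 'v set" where
  "path_cc E u v = {w. (u, w) \<in> E\<^sup>* \<and> (w, v) \<in> E\<^sup>*}"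

definition path_oc :: "('v \<times> 'v) set \<Rightarrow> 'v \<Rightarrow> 'v \<Rightarrow> 'v set" where
  "path_oc E u v = path_cc E u v - {u}"

definition Des_open :: "('v \<times> 'v) set \<Rightarrow> 'v \<Rightarrow> 'v \<Rightarrow> 'v set" where
  "Des_open E v u = Des E u - path_cc E u v"

definition Des_closed :: "('v \<times> 'v) set \<Rightarrow> 'v \<Rightarrow> 'v \<Rightarrow> 'v set" where
  "Des_closed E v u = Des E u - path_oc E u v"


section \<open>Join operations on the extended tree\<close>

text \<open>The extended vertex set is \<open>insert None (Some ` V)\<close> inside \<open>'v option\<close>; \<open>None\<close> plays the
  role of \<open>\<infinity>\<close>.\<close>

definition ext_edges :: "'v set \<Rightarrow> ('v \<times> 'v) set \<Rightarrow> ('v option \<times> 'v option) set" where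
  "ext_edges V E = {(Some u, Some v) | u v. (u, v) \<in> E} \<union> {(Some v, None) | v. v \<in> V}"

definition join :: "'v set \<Rightarrow> ('v \<times> 'v) set \<Rightarrow> 'v option \<Rightarrow> 'v option \<Rightarrow> 'v option" where
  "join V E x y =
    (if x \<in> Des (ext_edges V E) y then x
     else if y \<in> Des (ext_edges V E) x then y
     else None)"

definition meet :: "'v set \<Rightarrow> ('v \<times> 'v) set \<Rightarrow> 'v \<Rightarrow> 'v \<Rightarrow> 'v \<Rightarrow> 'v" where
  "meet V E rt u v =
    (ARG_MAX (depth E rt) w. w \<in> V \<and> (\<exists>m n. (w, u) \<in> E ^^ n \<and> (w, v) \<in> E ^^ m))"

definition join_at ::
    "'v set \<Rightarrow> ('v \<times> 'v) set \<Rightarrow> 'v \<Rightarrow> 'v \<Rightarrow> 'v option \<Rightarrow> 'v option \<Rightarrow> 'v option" where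
  "join_at V E rt b x y =
    (if x \<in> Some ` Asc E b \<and> y \<in> Some ` Asc E b then Some (meet V E rt (the x) (the y))
     else if y = Some b then x
     else if x = Some b then y
     else join V E x y)"


section \<open>The Hilbert space of square summable functions\<close>

text \<open>Elements of \<open>\<ell>\<^sup>2(V)\<close> are extended by zero outside \<open>V\<close>, so that \<open>ell2 U \<subseteq> ell2 V\<close> for
  \<open>U \<subseteq> V\<close>. Sums, differences and \<open>0\<close> of such functions are the pointwise ones.\<close>

definition ell2 :: "'v set \<Rightarrow> ('v \<Rightarrow> complex) set" where
  "ell2 V = {f. (\<forall>v. v \<notin> V \<longrightarrow> f v = 0) \<and> (\<lambda>v. (cmod (f v))\<^sup>2) summable_on V}"

definition ell2_inner :: "'v set \<Rightarrow> ('v \<Rightarrow> complex) \<Rightarrow> ('v \<Rightarrow> complex) \<Rightarrow> complex" where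
  "ell2_inner V f g = (\<Sum>\<^sub>\<infinity>v\<in>V. f v * cnj (g v))"

definition ell2_norm :: "'v set \<Rightarrow> ('v \<Rightarrow> complex) \<Rightarrow> real" where
  "ell2_norm V f = sqrt (\<Sum>\<^sub>\<infinity>v\<in>V. (cmod (f v))\<^sup>2)"

definition unit_fun :: "'v \<Rightarrow> 'v \<Rightarrow> complex" where
  "unit_fun v = (\<lambda>w. if w = v then 1 else 0)"

definition scaleF :: "complex \<Rightarrow> ('v \<Rightarrow> complex) \<Rightarrow> 'v \<Rightarrow> complex" where
  "scaleF c f = (\<lambda>v. c * f v)"

lemma vector_space_scaleF: "vector_space scaleF"
  by unfold_locales (auto simp: scaleF_def fun_eq_iff algebra_simps)

definition cspan :: "('v \<Rightarrow> complex) set \<Rightarrow> ('v \<Rightarrow> complex) set" where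
  "cspan = module.span scaleF"

definition closed_cspan :: "'v set \<Rightarrow> ('v \<Rightarrow> complex) set \<Rightarrow> ('v \<Rightarrow> complex) set" where
  "closed_cspan V S = {f \<in> ell2 V. \<forall>\<epsilon>>0. \<exists>g\<in>cspan S. ell2_norm V (f - g) < \<epsilon>}"

text \<open>\<open>orth_diff V M N\<close> is \<open>M \<ominus> N\<close>, and \<open>is_orth_sum V K M N\<close> says \<open>K = M \<oplus> N\<close>, including the
  orthogonality of the summands.\<close>

definition orth_diff ::
    "'v set \<Rightarrow> ('v \<Rightarrow> complex) set \<Rightarrow> ('v \<Rightarrow> complex) set \<Rightarrow> ('v \<Rightarrow> complex) set" where
  "orth_diff V M N = {f \<in> M. \<forall>g\<in>N. ell2_inner V f g = 0}"

definition is_orth_sum ::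
    "'v set \<Rightarrow> ('v \<Rightarrow> complex) set \<Rightarrow> ('v \<Rightarrow> complex) set \<Rightarrow> ('v \<Rightarrow> complex) set \<Rightarrow> bool" where
  "is_orth_sum V K M N \<longleftrightarrow>
     (\<forall>f\<in>M. \<forall>g\<in>N. ell2_inner V f g = 0) \<and> K = {f + g | f g. f \<in> M \<and> g \<in> N}"

definition orthonormal_basis ::
    "'v set \<Rightarrow> ('v \<Rightarrow> complex) set \<Rightarrow> ('v \<Rightarrow> complex) set \<Rightarrow> bool" where
  "orthonormal_basis V M B \<longleftrightarrow>
     B \<subseteq> ell2 V \<and> (\<forall>f\<in>B. \<forall>g\<in>B. ell2_inner V f g = (if f = g then 1 else 0)) \<and>
     closed_cspan V B = M"

text \<open>The dimension of a closed subspace is the cardinal number of an orthonormal basis.\<close>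

definition hilbert_dim :: "'v set \<Rightarrow> ('v \<Rightarrow> complex) set \<Rightarrow> ('v \<Rightarrow> complex) rel" where
  "hilbert_dim V M = |SOME B. orthonormal_basis V M B|"


section \<open>Unbounded operators and their spectra\<close>

text \<open>An operator in \<open>\<ell>\<^sup>2(V)\<close> is a domain together with an action; the action is only
  relevant on the domain.\<close>

datatype 'v operator =
  Operator (op_dom: "('v \<Rightarrow> complex) set") (op_app: "('v \<Rightarrow> complex) \<Rightarrow> 'v \<Rightarrow> complex")

definition op_shift :: "'v operator \<Rightarrow> complex \<Rightarrow> 'v operator" where
  "op_shift T \<mu> = Operator (op_dom T) (\<lambda>f. op_app T f - scaleF \<mu> f)"

primrec op_power :: "'v set \<Rightarrow> 'v operator \<Rightarrow> nat \<Rightarrow> 'v operator" where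
  "op_power V T 0 = Operator (ell2 V) (\<lambda>f. f)"
| "op_power V T (Suc k) =
     Operator {f \<in> op_dom T. op_app T f \<in> op_dom (op_power V T k)}
       (\<lambda>f. op_app (op_power V T k) (op_app T f))"

definition eigenspace :: "'v operator \<Rightarrow> complex \<Rightarrow> ('v \<Rightarrow> complex) set" where
  "eigenspace T \<mu> = {f \<in> op_dom T. op_app T f = scaleF \<mu> f}"

definition point_spectrum :: "'v operator \<Rightarrow> complex set" where
  "point_spectrum T = {\<mu>. \<exists>f\<in>eigenspace T \<mu>. f \<noteq> 0}"

definition resolvent_set :: "'v set \<Rightarrow> 'v operator \<Rightarrow> complex set" where
  "resolvent_set V T = {\<mu>.
     bij_betw (op_app (op_shift T \<mu>)) (op_dom T) (ell2 V) \<and>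
     (\<exists>C. \<forall>g\<in>ell2 V.
        ell2_norm V (the_inv_into (op_dom T) (op_app (op_shift T \<mu>)) g) \<le> C * ell2_norm V g)}"

definition spectrum :: "'v set \<Rightarrow> 'v operator \<Rightarrow> complex set" where
  "spectrum V T = - resolvent_set V T"

definition generalized_eigenvectors :: "'v set \<Rightarrow> 'v operator \<Rightarrow> complex \<Rightarrow> ('v \<Rightarrow> complex) set"
  where "generalized_eigenvectors V T \<mu> =
    {f. f \<noteq> 0 \<and> (\<exists>k>0. f \<in> op_dom (op_power V T k) \<and>
       op_app (op_power V (op_shift T \<mu>) k) f = 0)}"

definition generalized_eigenvalues :: "'v set \<Rightarrow> 'v operator \<Rightarrow> complex set" where
  "generalized_eigenvalues V T = {\<mu>. generalized_eigenvectors V T \<mu> \<noteq> {}}"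

definition rootspace :: "'v set \<Rightarrow> 'v operator \<Rightarrow> complex \<Rightarrow> ('v \<Rightarrow> complex) set" where
  "rootspace V T \<mu> = closed_cspan V (generalized_eigenvectors V T \<mu>)"

definition multiplicity_fun :: "'v set \<Rightarrow> 'v operator \<Rightarrow> complex \<Rightarrow> ('v \<Rightarrow> complex) rel" where
  "multiplicity_fun V T \<mu> = hilbert_dim V (eigenspace T \<mu>)"


section \<open>Weighted join operators\<close>

text \<open>A weight system is a function \<open>l\<close> on the extended vertices with \<open>l (Some v) = \<lambda>\<^sub>u\<^sub>v\<close> and
  \<open>l None = 0\<close>.\<close>

definition weighted_join_map ::
    "'v set \<Rightarrow> ('v \<times> 'v) set \<Rightarrow> 'v \<Rightarrow> 'v \<Rightarrow> 'v \<Rightarrow> ('v option \<Rightarrow> complex) \<Rightarrow>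
     ('v \<Rightarrow> complex) \<Rightarrow> 'v \<Rightarrow> complex" where
  "weighted_join_map V E rt b u l f =
     (\<lambda>w. \<Sum>\<^sub>\<infinity>v \<in> {v \<in> V. join_at V E rt b (Some u) (Some v) = Some w}. l (Some v) * f v)"

definition weighted_join_operator ::
    "'v set \<Rightarrow> ('v \<times> 'v) set \<Rightarrow> 'v \<Rightarrow> 'v \<Rightarrow> 'v \<Rightarrow> ('v option \<Rightarrow> complex) \<Rightarrow> 'v operator" where
  "weighted_join_operator V E rt b u l =
     Operator {f \<in> ell2 V. weighted_join_map V E rt b u l f \<in> ell2 V}
       (weighted_join_map V E rt b u l)"

definition diag_verts :: "('v \<times> 'v) set \<Rightarrow> 'v \<Rightarrow> 'v \<Rightarrow> 'v set" where
  "diag_verts E u b = (if b \<in> Des E u then Asc E u \<union> Des_open E b u else Des_open E u u)"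

definition rank_one_verts :: "('v \<times> 'v) set \<Rightarrow> 'v \<Rightarrow> 'v \<Rightarrow> 'v set" where
  "rank_one_verts E u b = (if b \<in> Des E u then path_cc E u b else Asc E u \<union> {b, u})"

definition weight_vector :: "('v option \<Rightarrow> complex) \<Rightarrow> 'v set \<Rightarrow> 'v \<Rightarrow> complex" where
  "weight_vector l A = (\<Sum>v\<in>A. scaleF (cnj (l (Some v))) (unit_fun v))"

end

theory Submission
  imports Defs "HOL-Library.Countable_Set_Type"
begin

text \<open>For fixed \<open>u\<close> the map \<open>v \<mapsto> u \<squnion>\<^sub>b v\<close> is very simple: it fixes the vertices of \<open>U\<close>, sends the finite
  set \<open>A\<^sub>u\<close> to \<open>u\<close>, and sends every other vertex to \<open>\<infinity>\<close> (\<open>join_at_eq\<close>). Therefore the weighted join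
  operator is the orthogonal sum of a diagonal operator on \<open>\<ell>\<^sup>2(U)\<close> and the rank one operator
  \<open>f \<mapsto> \<langle>f, e\<rangle> e\<^sub>u\<close>, with \<open>e\<close> of finite support, on the complement (\<open>weighted_join_map_eq\<close>). The rest is
  operator theory of such sums, carried out in the locale \<open>diag_rank_one\<close>.

  An eigenvector for \<open>\<mu> \<noteq> 0\<close> is supported in \<open>U \<union> {u}\<close>, where the operator acts like a diagonal
  one, so the eigenspace is \<open>\<ell>\<^sup>2\<close> of a level set of the weights. The kernel consists of the functions
  supported where the diagonal part vanishes and orthogonal to \<open>e\<close>. The value \<open>0\<close> is always an
  eigenvalue because \<open>A\<^sub>u\<close> has at least two elements.

  An eigenvector shows that a bounded resolvent keeps its distance from the eigenvalues. Conversely,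
  at positive distance from all eigenvalues the resolvent equation is solved explicitly, vertex by
  vertex and finally at \<open>u\<close>, with a uniform bound. So the spectrum is the closure of the point
  spectrum.

  The dimension of a closed subspace is a cardinal of a chosen orthonormal basis. Hence it has to be
  shown that any two bases are equipotent (Parseval, Bessel, and countability of orthonormal sets)
  and that the eigenspaces have bases at all. For spaces \<open>\<ell>\<^sup>2(S)\<close> the unit vectors form one. For the
  kernel, a Householder reflection that maps \<open>e\<close> to a multiple of \<open>e\<^sub>u\<close> carries the unit vectors other
  than \<open>e\<^sub>u\<close> to a basis. If the tree is leafless and branches above \<open>u\<close>, infinitely many vertices are
  incomparable with \<open>u\<close>; their unit vectors, except possibly the one at \<open>b\<close>, lie in the kernel.

  For rootspaces, powers of the operator minus \<open>\<mu>\<close> act pointwise by powers of scalars, except for the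
  rank one part. That part produces new generalized eigenvectors only for \<open>\<mu> = 0\<close> and
  \<open>\<lambda>\<^sub>u\<^sub>u = 0\<close>, when it is nilpotent of order two; then the vector \<open>e\<close> is added to the kernel.\<close>

section \<open>The geometry of square summable functions\<close>

lemma scaleF_apply [simp]: "scaleF c f v = c * f v"
  by (simp add: scaleF_def)

lemma unit_fun_apply [simp]: "unit_fun v w = (if w = v then 1 else 0)"
  by (simp add: unit_fun_def)

lemma sum_fun_eval: "(\<Sum>i\<in>I. F i) v = (\<Sum>i\<in>I. F i v)"
  for F :: "'i \<Rightarrow> 'v \<Rightarrow> complex"
  by (induction I rule: infinite_finite_induct) auto

lemma ell2_vanish: "f \<in> ell2 V \<Longrightarrow> v \<notin> V \<Longrightarrow> f v = 0"
  by (simp add: ell2_def)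

lemma ell2_summable: "f \<in> ell2 V \<Longrightarrow> (\<lambda>v. (cmod (f v))\<^sup>2) summable_on V"
  by (simp add: ell2_def)

lemma ell2_dominated:
  assumes "f \<in> ell2 V" "\<And>v. v \<in> V \<Longrightarrow> cmod (g v) \<le> K * cmod (f v)" "\<And>v. v \<notin> V \<Longrightarrow> g v = 0"
  shows "g \<in> ell2 V"
proof -
  have "(\<lambda>v. K\<^sup>2 * (cmod (f v))\<^sup>2) summable_on V"
    using ell2_summable[OF assms(1)] by (rule summable_on_cmult_right)
  moreover have "(cmod (g v))\<^sup>2 \<le> K\<^sup>2 * (cmod (f v))\<^sup>2" if "v \<in> V" for v
    using power_mono[OF assms(2)[OF that], of 2] by (simp add: power_mult_distrib)
  ultimately have "(\<lambda>v. (cmod (g v))\<^sup>2) summable_on V"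
    by (rule summable_on_comparison_test) auto
  then show ?thesis using assms(3) by (simp add: ell2_def)
qed

lemma ell2_zero [simp]: "0 \<in> ell2 V"
  by (simp add: ell2_def)

lemma ell2_scale: "f \<in> ell2 V \<Longrightarrow> scaleF c f \<in> ell2 V"
  by (rule ell2_dominated[where f = f and K = "cmod c"])
    (auto simp: norm_mult ell2_vanish)

lemma ell2_add:
  assumes "f \<in> ell2 V" "g \<in> ell2 V"
  shows "f + g \<in> ell2 V"
proof -
  have "(\<lambda>v. 2 * (cmod (f v))\<^sup>2 + 2 * (cmod (g v))\<^sup>2) summable_on V"
    using assms by (intro summable_on_add summable_on_cmult_right ell2_summable)
  moreover have "(cmod ((f + g) v))\<^sup>2 \<le> 2 * (cmod (f v))\<^sup>2 + 2 * (cmod (g v))\<^sup>2" for v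
  proof -
    have "(cmod ((f + g) v))\<^sup>2 \<le> (cmod (f v) + cmod (g v))\<^sup>2"
      by (intro power_mono) (auto simp: norm_triangle_ineq)
    also have "\<dots> \<le> 2 * (cmod (f v))\<^sup>2 + 2 * (cmod (g v))\<^sup>2"
      using sum_squares_bound[of "cmod (f v)" "cmod (g v)"] by (simp add: power2_sum)
    finally show ?thesis .
  qed
  ultimately have "(\<lambda>v. (cmod ((f + g) v))\<^sup>2) summable_on V"
    by (rule summable_on_comparison_test) auto
  then show ?thesis using assms by (simp add: ell2_def)
qed

lemma diff_conv_scaleF: "f - g = f + scaleF (-1) g"
  by (auto simp: fun_eq_iff)

lemma ell2_diff: "f \<in> ell2 V \<Longrightarrow> g \<in> ell2 V \<Longrightarrow> f - g \<in> ell2 V"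
  unfolding diff_conv_scaleF by (intro ell2_add ell2_scale)

lemma ell2_sum: "(\<And>i. i \<in> I \<Longrightarrow> F i \<in> ell2 V) \<Longrightarrow> (\<Sum>i\<in>I. F i) \<in> ell2 V"
  by (induction I rule: infinite_finite_induct) (auto intro: ell2_add)

lemma ell2_finite_support:
  assumes "finite F" "F \<subseteq> V" "\<And>v. v \<notin> F \<Longrightarrow> f v = 0"
  shows "f \<in> ell2 V"
proof -
  have "(\<lambda>v. (cmod (f v))\<^sup>2) summable_on V \<longleftrightarrow> (\<lambda>v. (cmod (f v))\<^sup>2) summable_on F"
    using assms by (intro summable_on_cong_neutral) auto
  then show ?thesis using assms by (auto simp: ell2_def)
qed

lemma ell2_unit: "v \<in> V \<Longrightarrow> unit_fun v \<in> ell2 V"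
  by (rule ell2_finite_support[of "{v}"]) auto

lemma ell2_subset_iff:
  assumes "S \<subseteq> V"
  shows "f \<in> ell2 S \<longleftrightarrow> f \<in> ell2 V \<and> (\<forall>v. v \<notin> S \<longrightarrow> f v = 0)"
proof -
  have "(\<lambda>v. (cmod (f v))\<^sup>2) summable_on V \<longleftrightarrow> (\<lambda>v. (cmod (f v))\<^sup>2) summable_on S"
    if "\<forall>v. v \<notin> S \<longrightarrow> f v = 0"
    using assms that by (intro summable_on_cong_neutral) auto
  then show ?thesis using assms by (auto simp: ell2_def)
qed

lemma ell2_inner_summable:
  assumes "f \<in> ell2 V" "g \<in> ell2 V"
  shows "(\<lambda>v. f v * cnj (g v)) summable_on V"
proof (rule abs_summable_summable)
  have "(\<lambda>v. (cmod (f v))\<^sup>2 + (cmod (g v))\<^sup>2) summable_on V"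
    using assms by (intro summable_on_add ell2_summable)
  moreover have "norm (f v * cnj (g v)) \<le> (cmod (f v))\<^sup>2 + (cmod (g v))\<^sup>2" for v
  proof -
    have "norm (f v * cnj (g v)) \<le> 2 * cmod (f v) * cmod (g v)"
      by (simp add: norm_mult)
    also have "\<dots> \<le> (cmod (f v))\<^sup>2 + (cmod (g v))\<^sup>2" by (rule sum_squares_bound)
    finally show ?thesis .
  qed
  ultimately show "(\<lambda>v. norm (f v * cnj (g v))) summable_on V"
    by (rule summable_on_comparison_test) auto
qed

lemma ell2_inner_add_left:
  assumes "f \<in> ell2 V" "g \<in> ell2 V" "h \<in> ell2 V"
  shows "ell2_inner V (f + g) h = ell2_inner V f h + ell2_inner V g h"
  using infsum_add[OF ell2_inner_summable ell2_inner_summable, OF assms(1,3,2,3)]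
  by (simp add: ell2_inner_def distrib_right)

lemma ell2_inner_scale_left: "ell2_inner V (scaleF c f) g = c * ell2_inner V f g"
  by (simp add: ell2_inner_def mult.assoc infsum_cmult_right')

lemma ell2_inner_commute: "ell2_inner V g f = cnj (ell2_inner V f g)"
  unfolding ell2_inner_def infsum_cnj[symmetric] by (simp add: mult.commute)

lemma ell2_inner_zero_left [simp]: "ell2_inner V 0 f = 0"
  by (simp add: ell2_inner_def)

lemma ell2_inner_zero_right [simp]: "ell2_inner V f 0 = 0"
  by (simp add: ell2_inner_def)

lemma ell2_inner_diff_left:
  assumes "f \<in> ell2 V" "g \<in> ell2 V" "h \<in> ell2 V"
  shows "ell2_inner V (f - g) h = ell2_inner V f h - ell2_inner V g h"
  unfolding diff_conv_scaleF
  by (subst ell2_inner_add_left) (auto intro: ell2_scale assms simp: ell2_inner_scale_left)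

lemma ell2_inner_sum_left:
  assumes "\<And>i. i \<in> I \<Longrightarrow> F i \<in> ell2 V" "h \<in> ell2 V"
  shows "ell2_inner V (\<Sum>i\<in>I. F i) h = (\<Sum>i\<in>I. ell2_inner V (F i) h)"
  using assms(1)
  by (induction I rule: infinite_finite_induct)
    (auto simp: ell2_inner_add_left ell2_sum assms(2))

lemma ell2_inner_scale_right: "ell2_inner V f (scaleF c g) = cnj c * ell2_inner V f g"
  by (metis ell2_inner_commute ell2_inner_scale_left complex_cnj_mult complex_cnj_cnj)

lemma ell2_inner_add_right:
  assumes "f \<in> ell2 V" "g \<in> ell2 V" "h \<in> ell2 V"
  shows "ell2_inner V h (f + g) = ell2_inner V h f + ell2_inner V h g"
  by (metis (no_types) assms ell2_inner_commute ell2_inner_add_left complex_cnj_add)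

lemma ell2_inner_diff_right:
  assumes "f \<in> ell2 V" "g \<in> ell2 V" "h \<in> ell2 V"
  shows "ell2_inner V h (f - g) = ell2_inner V h f - ell2_inner V h g"
  by (metis (no_types) assms ell2_inner_commute ell2_inner_diff_left complex_cnj_diff)

lemma ell2_inner_sum_right:
  assumes "\<And>i. i \<in> I \<Longrightarrow> F i \<in> ell2 V" "h \<in> ell2 V"
  shows "ell2_inner V h (\<Sum>i\<in>I. F i) = (\<Sum>i\<in>I. ell2_inner V h (F i))"
proof -
  have "ell2_inner V h (\<Sum>i\<in>I. F i) = cnj (\<Sum>i\<in>I. ell2_inner V (F i) h)"
    by (subst ell2_inner_commute) (simp add: ell2_inner_sum_left[OF assms])
  also have "\<dots> = (\<Sum>i\<in>I. ell2_inner V h (F i))"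
    unfolding cnj_sum by (intro sum.cong refl) (rule ell2_inner_commute[symmetric])
  finally show ?thesis .
qed

lemma ell2_inner_finite_support:
  assumes "finite F" "F \<subseteq> V" "\<And>v. v \<notin> F \<Longrightarrow> g v = 0"
  shows "ell2_inner V f g = (\<Sum>v\<in>F. f v * cnj (g v))"
proof -
  have "ell2_inner V f g = (\<Sum>\<^sub>\<infinity>v\<in>F. f v * cnj (g v))"
    unfolding ell2_inner_def using assms by (intro infsum_cong_neutral) auto
  then show ?thesis using assms(1) by simp
qed

lemma ell2_inner_unit_right: "v \<in> V \<Longrightarrow> ell2_inner V f (unit_fun v) = f v"
  by (subst ell2_inner_finite_support[of "{v}"]) auto

lemma ell2_inner_disjoint:
  assumes "\<And>v. v \<in> V \<Longrightarrow> f v = 0 \<or> g v = 0"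
  shows "ell2_inner V f g = 0"
  unfolding ell2_inner_def using assms by (intro infsum_0) auto

lemma ell2_norm_nonneg [simp]: "0 \<le> ell2_norm V f"
  unfolding ell2_norm_def by (intro real_sqrt_ge_zero infsum_nonneg) auto

lemma ell2_norm_sq: "(ell2_norm V f)\<^sup>2 = (\<Sum>\<^sub>\<infinity>v\<in>V. (cmod (f v))\<^sup>2)"
  unfolding ell2_norm_def by (intro real_sqrt_pow2 infsum_nonneg) auto

lemma ell2_inner_self: "f \<in> ell2 V \<Longrightarrow> ell2_inner V f f = of_real ((ell2_norm V f)\<^sup>2)"
proof -
  assume "f \<in> ell2 V"
  note True = ell2_summable[OF this]
  have "of_real ((ell2_norm V f)\<^sup>2) = (\<Sum>\<^sub>\<infinity>v\<in>V. complex_of_real ((cmod (f v))\<^sup>2))"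
    unfolding ell2_norm_sq
    using has_sum_of_real[OF has_sum_infsum[OF True], where 'a = complex] by (simp only: infsumI)
  then show ?thesis by (simp only: ell2_inner_def complex_norm_square)
qed

lemma ell2_norm_zero [simp]: "ell2_norm V 0 = 0"
  by (simp add: ell2_norm_def)

lemma ell2_norm_scale: "ell2_norm V (scaleF c f) = cmod c * ell2_norm V f"
  unfolding ell2_norm_def
  by (simp add: norm_mult power_mult_distrib infsum_cmult_right' real_sqrt_mult)

lemma cmod_le_ell2_norm:
  assumes "f \<in> ell2 V"
  shows "cmod (f v) \<le> ell2_norm V f"
proof (cases "v \<in> V")
  case True
  have "(\<Sum>v\<in>{v}. (cmod (f v))\<^sup>2) \<le> (\<Sum>\<^sub>\<infinity>v\<in>V. (cmod (f v))\<^sup>2)"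
    using assms True by (intro finite_sum_le_infsum ell2_summable) auto
  then show ?thesis unfolding ell2_norm_def by (simp add: real_le_rsqrt)
next
  case False
  then show ?thesis using assms by (simp add: ell2_vanish)
qed

lemma ell2_norm_eq_0_iff:
  assumes "f \<in> ell2 V"
  shows "ell2_norm V f = 0 \<longleftrightarrow> f = 0"
proof
  assume *: "ell2_norm V f = 0"
  show "f = 0"
  proof
    fix v show "f v = 0 v" using cmod_le_ell2_norm[OF assms, of v] * by simp
  qed
qed simp

lemma ell2_norm_unit: "v \<in> V \<Longrightarrow> ell2_norm V (unit_fun v) = 1"
proof -
  assume v: "v \<in> V"
  have "complex_of_real ((ell2_norm V (unit_fun v))\<^sup>2) = of_real (1\<^sup>2)"
    using ell2_inner_unit_right[OF v, of "unit_fun v"]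
    by (simp add: ell2_inner_self ell2_unit v)
  then show ?thesis unfolding of_real_eq_iff by (rule power2_eq_imp_eq) auto
qed

lemma ell2_norm_dominated:
  assumes "f \<in> ell2 V" "\<And>v. v \<in> V \<Longrightarrow> cmod (g v) \<le> K * cmod (f v)" "\<And>v. v \<notin> V \<Longrightarrow> g v = 0"
    and "0 \<le> K"
  shows "ell2_norm V g \<le> K * ell2_norm V f"
proof -
  have g: "g \<in> ell2 V" using ell2_dominated[OF assms(1-3)] by simp
  have "(cmod (g v))\<^sup>2 \<le> K\<^sup>2 * (cmod (f v))\<^sup>2" if "v \<in> V" for v
    using power_mono[OF assms(2)[OF that], of 2] by (simp add: power_mult_distrib)
  then have "(\<Sum>\<^sub>\<infinity>v\<in>V. (cmod (g v))\<^sup>2) \<le> (\<Sum>\<^sub>\<infinity>v\<in>V. K\<^sup>2 * (cmod (f v))\<^sup>2)"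
    using assms(1) g by (intro infsum_mono summable_on_cmult_right ell2_summable)
  then have "(ell2_norm V g)\<^sup>2 \<le> (K * ell2_norm V f)\<^sup>2"
    by (simp add: ell2_norm_sq power_mult_distrib infsum_cmult_right')
  then show ?thesis
    by (rule power2_le_imp_le) (simp add: assms(4))
qed

text \<open>Expand \<open>0 \<le> \<parallel>f - t g\<parallel>\<^sup>2\<close> at the minimising scalar \<open>t = \<langle>f, g\<rangle> / \<parallel>g\<parallel>\<^sup>2\<close>.\<close>

lemma ell2_Cauchy_Schwarz:
  assumes f: "f \<in> ell2 V" and g: "g \<in> ell2 V"
  shows "cmod (ell2_inner V f g) \<le> ell2_norm V f * ell2_norm V g"
proof (cases "ell2_norm V g = 0")
  case True
  then show ?thesis using g by (simp add: ell2_norm_eq_0_iff)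
next
  case False
  define n where "n = ell2_norm V g"
  define a where "a = ell2_inner V f g"
  have n: "n > 0" using False ell2_norm_nonneg[of V g] unfolding n_def by linarith
  define h where "h = f - scaleF (a / n\<^sup>2) g"
  have h: "h \<in> ell2 V" unfolding h_def by (intro ell2_diff ell2_scale f g)
  have gh: "ell2_inner V g h = 0"
    using n unfolding h_def
    by (simp add: ell2_inner_diff_right ell2_inner_scale_right ell2_inner_self f g ell2_scale
        ell2_inner_commute[of V g f] flip: n_def a_def)
  have "of_real ((ell2_norm V h)\<^sup>2) = ell2_inner V f h - (a / n\<^sup>2) * ell2_inner V g h"
    unfolding ell2_inner_self[OF h, symmetric] ell2_inner_scale_left[symmetric]
    using ell2_inner_diff_left[OF f ell2_scale[OF g] h] by (simp add: h_def)
  also have "\<dots> = of_real ((ell2_norm V f)\<^sup>2) - cnj a * a / n\<^sup>2"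
    unfolding gh unfolding h_def
    by (simp add: ell2_inner_diff_right f g ell2_scale ell2_inner_scale_right ell2_inner_self
        flip: a_def)
  also have "cnj a * a = of_real ((cmod a)\<^sup>2)"
    by (simp only: complex_norm_square mult.commute)
  finally have "of_real ((ell2_norm V h)\<^sup>2)
      = (of_real ((ell2_norm V f)\<^sup>2 - (cmod a)\<^sup>2 / n\<^sup>2) :: complex)"
    by simp
  then have "(ell2_norm V h)\<^sup>2 = (ell2_norm V f)\<^sup>2 - (cmod a)\<^sup>2 / n\<^sup>2"
    by (simp only: of_real_eq_iff)
  then have "(cmod a)\<^sup>2 / n\<^sup>2 \<le> (ell2_norm V f)\<^sup>2"
    using zero_le_power2[of "ell2_norm V h"] by linarith
  then have "(cmod a)\<^sup>2 \<le> (ell2_norm V f * n)\<^sup>2"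
    using n by (simp add: field_simps)
  then show ?thesis
    unfolding a_def n_def by (rule power2_le_imp_le) simp
qed

lemma ell2_norm_add_sq:
  assumes f: "f \<in> ell2 V" and g: "g \<in> ell2 V"
  shows "(ell2_norm V (f + g))\<^sup>2
    = (ell2_norm V f)\<^sup>2 + 2 * Re (ell2_inner V f g) + (ell2_norm V g)\<^sup>2"
proof -
  have "ell2_inner V (f + g) (f + g)
      = ell2_inner V f f + (ell2_inner V f g + cnj (ell2_inner V f g)) + ell2_inner V g g"
    by (simp add: ell2_inner_add_left ell2_inner_add_right f g ell2_add
        ell2_inner_commute[of V g f])
  then show ?thesis
    by (simp only: ell2_inner_self ell2_add f g complex_add_cnj flip: of_real_add of_real_eq_iff[where 'a = complex])
qed

lemma ell2_norm_triangle:
  assumes f: "f \<in> ell2 V" and g: "g \<in> ell2 V"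
  shows "ell2_norm V (f + g) \<le> ell2_norm V f + ell2_norm V g"
proof (rule power2_le_imp_le)
  have "Re (ell2_inner V f g) \<le> ell2_norm V f * ell2_norm V g"
    using ell2_Cauchy_Schwarz[OF f g] complex_Re_le_cmod[of "ell2_inner V f g"] by linarith
  then show "(ell2_norm V (f + g))\<^sup>2 \<le> (ell2_norm V f + ell2_norm V g)\<^sup>2"
    by (simp add: ell2_norm_add_sq f g power2_sum)
qed simp

text \<open>The finitely supported truncations of \<open>f\<close> converge to \<open>f\<close>, because the tails of a
  convergent sum tend to zero.\<close>

lemma ell2_finite_approximation:
  assumes f: "f \<in> ell2 V" and "0 < \<epsilon>"
  obtains F where "finite F" "F \<subseteq> V" "ell2_norm V (f - (\<Sum>v\<in>F. scaleF (f v) (unit_fun v))) < \<epsilon>"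
proof -
  let ?q = "\<lambda>v. (cmod (f v))\<^sup>2"
  have "0 < \<epsilon>\<^sup>2 / 2" using assms(2) by simp
  then obtain F where F: "finite F" "F \<subseteq> V" and d: "dist (sum ?q F) (infsum ?q V) \<le> \<epsilon>\<^sup>2 / 2"
    using infsum_finite_approximation[OF ell2_summable[OF f]] by blast
  define h where "h = f - (\<Sum>v\<in>F. scaleF (f v) (unit_fun v))"
  have h: "h v = (if v \<in> F then 0 else f v)" for v
  proof -
    have "(\<Sum>x\<in>F. f x * (if v = x then 1 else 0)) = (\<Sum>x\<in>F. if v = x then f x else 0)"
      by (intro sum.cong) auto
    then show ?thesis using F(1) by (simp add: h_def sum_fun_eval)
  qed
  have "(ell2_norm V h)\<^sup>2 = infsum ?q (V - F)"
    unfolding ell2_norm_sq by (intro infsum_cong_neutral) (auto simp: h)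
  also have "\<dots> = infsum ?q V - sum ?q F"
    using F by (subst infsum_Diff) (auto intro: ell2_summable f)
  also have "\<dots> < \<epsilon>\<^sup>2" using d \<open>0 < \<epsilon>\<^sup>2 / 2\<close> unfolding dist_real_def by linarith
  finally have "ell2_norm V h < \<epsilon>"
    by (rule power2_less_imp_less) (use assms(2) in simp)
  then show ?thesis using that F unfolding h_def by blast
qed

section \<open>Spans and closed subspaces\<close>

lemmas module_scaleF = vector_space_scaleF[unfolded module_iff_vector_space[symmetric]]

lemma cspan_base: "f \<in> S \<Longrightarrow> f \<in> cspan S"
  unfolding cspan_def by (rule module.span_base[OF module_scaleF])

lemma cspan_zero: "0 \<in> cspan S"
  unfolding cspan_def by (rule module.span_zero[OF module_scaleF])

lemma cspan_add: "f \<in> cspan S \<Longrightarrow> g \<in> cspan S \<Longrightarrow> f + g \<in> cspan S"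
  unfolding cspan_def by (rule module.span_add[OF module_scaleF])

lemma cspan_scale: "f \<in> cspan S \<Longrightarrow> scaleF c f \<in> cspan S"
  unfolding cspan_def by (rule module.span_scale[OF module_scaleF])

lemma cspan_sum: "(\<And>i. i \<in> I \<Longrightarrow> F i \<in> cspan S) \<Longrightarrow> (\<Sum>i\<in>I. F i) \<in> cspan S"
  unfolding cspan_def by (rule module.span_sum[OF module_scaleF])

lemma cspan_least:
  assumes "S \<subseteq> M" "0 \<in> M" "\<And>f g. f \<in> M \<Longrightarrow> g \<in> M \<Longrightarrow> f + g \<in> M"
    "\<And>c f. f \<in> M \<Longrightarrow> scaleF c f \<in> M"
  shows "cspan S \<subseteq> M"
  unfolding cspan_def
  by (rule module.span_minimal[OF module_scaleF])
    (use assms in \<open>auto simp: module.subspace_def[OF module_scaleF]\<close>)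

lemma cspan_singleton: "cspan {f} = range (\<lambda>c. scaleF c f)"
  unfolding cspan_def by (rule module.span_singleton[OF module_scaleF])

lemma closed_cspan_superset:
  assumes "S \<subseteq> ell2 V"
  shows "S \<subseteq> closed_cspan V S"
proof
  fix f assume "f \<in> S"
  then show "f \<in> closed_cspan V S"
    using assms cspan_base[of f S] by (auto simp: closed_cspan_def intro!: bexI[of _ f])
qed

abbreviation (input) orth_compl :: "'v set \<Rightarrow> ('v \<Rightarrow> complex) set \<Rightarrow> ('v \<Rightarrow> complex) set" where
  "orth_compl V G \<equiv> orth_diff V (ell2 V) G"

text \<open>Orthogonal complements are closed subspaces by the Cauchy-Schwarz inequality. All
  eigenspaces and rootspaces below are obtained as orthogonal complements, so this is the only
  form in which closedness enters.\<close>

lemma closed_cspan_subset_orth_compl: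
  assumes G: "G \<subseteq> ell2 V" and S: "S \<subseteq> orth_compl V G"
  shows "closed_cspan V S \<subseteq> orth_compl V G"
proof
  fix f assume f: "f \<in> closed_cspan V S"
  then have fV: "f \<in> ell2 V" by (simp add: closed_cspan_def)
  have span: "cspan S \<subseteq> orth_compl V G"
    using G S
    by (intro cspan_least)
      (auto simp: orth_diff_def ell2_add ell2_scale ell2_inner_add_left ell2_inner_scale_left
        subset_iff)
  have "ell2_inner V f g = 0" if "g \<in> G" for g
  proof (rule ccontr)
    assume ne: "ell2_inner V f g \<noteq> 0"
    have g: "g \<in> ell2 V" using G that by auto
    define \<epsilon> where "\<epsilon> = cmod (ell2_inner V f g) / (ell2_norm V g + 1)"
    have pos: "0 < ell2_norm V g + 1" using ell2_norm_nonneg[of V g] by linarith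
    have "\<epsilon> > 0" using ne pos by (simp add: \<epsilon>_def)
    then obtain h where h: "h \<in> cspan S" "ell2_norm V (f - h) < \<epsilon>"
      using f by (auto simp: closed_cspan_def)
    have hV: "h \<in> ell2 V" and "ell2_inner V h g = 0"
      using h(1) span that by (auto simp: orth_diff_def)
    then have "cmod (ell2_inner V f g) = cmod (ell2_inner V (f - h) g)"
      by (simp add: ell2_inner_diff_left fV g)
    also have "\<dots> \<le> ell2_norm V (f - h) * ell2_norm V g"
      by (intro ell2_Cauchy_Schwarz ell2_diff fV hV g)
    also have "\<dots> \<le> \<epsilon> * ell2_norm V g"
      using h(2) by (intro mult_right_mono) auto
    also have "\<dots> < \<epsilon> * (ell2_norm V g + 1)"
      using \<open>\<epsilon> > 0\<close> by simp
    also have "\<dots> = cmod (ell2_inner V f g)"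
      using pos by (simp add: \<epsilon>_def)
    finally show False by simp
  qed
  then show "f \<in> orth_compl V G" using fV by (simp add: orth_diff_def)
qed

text \<open>Generalized eigenvectors are non-zero by definition, so rootspaces arise as closed spans of
  subspaces without their zero vector.\<close>

lemma orth_compl_closed_cspan:
  assumes "G \<subseteq> ell2 V"
  shows "closed_cspan V (orth_compl V G - {0}) = orth_compl V G"
proof
  show "closed_cspan V (orth_compl V G - {0}) \<subseteq> orth_compl V G"
    by (rule closed_cspan_subset_orth_compl[OF assms]) auto
next
  have "f \<in> closed_cspan V (orth_compl V G - {0})" if "f \<in> orth_compl V G" for f
  proof (cases "f = 0")
    case True
    then show ?thesis using cspan_zero by (auto simp: closed_cspan_def intro!: bexI[of _ 0])
  next
    case False
    then show ?thesis
      using that closed_cspan_superset[of "orth_compl V G - {0}" V]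
      by (auto simp: orth_diff_def)
  qed
  then show "orth_compl V G \<subseteq> closed_cspan V (orth_compl V G - {0})" by blast
qed

lemma ell2_eq_orth_compl:
  assumes "S \<subseteq> V"
  shows "ell2 S = orth_compl V (unit_fun ` (V - S))"
proof (rule set_eqI)
  fix f
  have "(\<forall>v. v \<notin> S \<longrightarrow> f v = 0) \<longleftrightarrow> (\<forall>v\<in>V - S. f v = 0)" if "f \<in> ell2 V"
    using ell2_vanish[OF that] by blast
  then show "f \<in> ell2 S \<longleftrightarrow> f \<in> orth_compl V (unit_fun ` (V - S))"
    unfolding ell2_subset_iff[OF assms] orth_diff_def
    by (auto simp: ell2_inner_unit_right)
qed

lemma cspan_unit_dense:
  assumes "S \<subseteq> V"
  shows "closed_cspan V (unit_fun ` S) = ell2 S"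
proof
  have "unit_fun ` S \<subseteq> ell2 S" by (auto intro: ell2_unit)
  then show "closed_cspan V (unit_fun ` S) \<subseteq> ell2 S"
    unfolding ell2_eq_orth_compl[OF assms]
    by (rule closed_cspan_subset_orth_compl[rotated]) (auto intro: ell2_unit)
next
  show "ell2 S \<subseteq> closed_cspan V (unit_fun ` S)"
  proof
    fix f assume f: "f \<in> ell2 S"
    have fV: "f \<in> ell2 V" using f assms by (simp add: ell2_subset_iff)
    have "\<exists>g\<in>cspan (unit_fun ` S). ell2_norm V (f - g) < \<epsilon>" if pos: "\<epsilon> > 0" for \<epsilon>
    proof -
      obtain F where F: "finite F" "F \<subseteq> V"
          "ell2_norm V (f - (\<Sum>v\<in>F. scaleF (f v) (unit_fun v))) < \<epsilon>"
        by (rule ell2_finite_approximation[OF fV pos])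
      have "scaleF (f v) (unit_fun v) \<in> cspan (unit_fun ` S)" for v
      proof (cases "v \<in> S")
        case True
        then show ?thesis by (intro cspan_scale cspan_base) auto
      next
        case False
        then have "scaleF (f v) (unit_fun v) = 0"
          using f by (auto simp: fun_eq_iff ell2_vanish)
        then show ?thesis by (simp only: cspan_zero)
      qed
      then have "(\<Sum>v\<in>F. scaleF (f v) (unit_fun v)) \<in> cspan (unit_fun ` S)" by (rule cspan_sum)
      with F(3) show ?thesis by (rule bexI)
    qed
    then show "f \<in> closed_cspan V (unit_fun ` S)" using fV by (simp add: closed_cspan_def)
  qed
qed

section \<open>Orthonormal bases and Hilbert dimension\<close>

definition orthonormal :: "'v set \<Rightarrow> ('v \<Rightarrow> complex) set \<Rightarrow> bool" where
  "orthonormal V B \<longleftrightarrow>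
     B \<subseteq> ell2 V \<and> (\<forall>f\<in>B. \<forall>g\<in>B. ell2_inner V f g = (if f = g then 1 else 0))"

lemma orthonormal_basis_iff:
  "orthonormal_basis V M B \<longleftrightarrow> orthonormal V B \<and> closed_cspan V B = M"
  by (auto simp: orthonormal_basis_def orthonormal_def)

lemma orthonormal_norm:
  assumes "orthonormal V B" "b \<in> B"
  shows "ell2_norm V b = 1"
proof -
  have "complex_of_real ((ell2_norm V b)\<^sup>2) = of_real (1\<^sup>2)"
    using assms ell2_inner_self[of b V] by (auto simp: orthonormal_def)
  then show ?thesis unfolding of_real_eq_iff by (rule power2_eq_imp_eq) auto
qed

lemma orthonormal_mono: "orthonormal V B \<Longrightarrow> S \<subseteq> B \<Longrightarrow> orthonormal V S"
  unfolding orthonormal_def by blast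

definition projection_sum ::
    "'v set \<Rightarrow> ('v \<Rightarrow> complex) set \<Rightarrow> ('v \<Rightarrow> complex) \<Rightarrow> 'v \<Rightarrow> complex" where
  "projection_sum V F f = (\<Sum>b\<in>F. scaleF (ell2_inner V f b) b)"

lemma projection_sum_defect:
  assumes F: "finite F" "orthonormal V F" and f: "f \<in> ell2 V"
  shows "projection_sum V F f \<in> ell2 V"
    and "b \<in> F \<Longrightarrow> ell2_inner V (f - projection_sum V F f) b = 0"
    and "ell2_inner V (f - projection_sum V F f) (projection_sum V F f) = 0"
    and "(ell2_norm V (f - projection_sum V F f))\<^sup>2
      = (ell2_norm V f)\<^sup>2 - (\<Sum>b\<in>F. (cmod (ell2_inner V f b))\<^sup>2)"
proof -
  let ?p = "projection_sum V F f"
  have FV: "b \<in> ell2 V" if "b \<in> F" for b using F(2) that by (auto simp: orthonormal_def)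
  show p: "?p \<in> ell2 V"
    unfolding projection_sum_def by (intro ell2_sum ell2_scale FV)
  have pb: "ell2_inner V ?p c = ell2_inner V f c" if "c \<in> F" for c
  proof -
    have "ell2_inner V ?p c = (\<Sum>b\<in>F. ell2_inner V f b * ell2_inner V b c)"
      unfolding projection_sum_def using FV that
      by (subst ell2_inner_sum_left) (auto intro: ell2_scale simp: ell2_inner_scale_left)
    also have "\<dots> = (\<Sum>b\<in>F. if b = c then ell2_inner V f b else 0)"
      using F(2) that by (intro sum.cong) (auto simp: orthonormal_def)
    finally show ?thesis using F(1) that by simp
  qed
  show hb: "ell2_inner V (f - ?p) b = 0" if "b \<in> F" for b
    using that by (simp add: ell2_inner_diff_left f p FV pb)
  have h: "f - ?p \<in> ell2 V" by (intro ell2_diff f p)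
  show hp: "ell2_inner V (f - ?p) ?p = 0"
    by (subst (2) projection_sum_def, subst ell2_inner_sum_right)
      (auto intro: ell2_scale FV h simp: ell2_inner_scale_right hb)
  have pf: "ell2_inner V ?p f = of_real (\<Sum>b\<in>F. (cmod (ell2_inner V f b))\<^sup>2)"
  proof -
    have "ell2_inner V ?p f = (\<Sum>b\<in>F. ell2_inner V f b * ell2_inner V b f)"
      unfolding projection_sum_def using FV f
      by (subst ell2_inner_sum_left) (auto intro: ell2_scale simp: ell2_inner_scale_left)
    also have "\<dots> = (\<Sum>b\<in>F. of_real ((cmod (ell2_inner V f b))\<^sup>2))"
      by (intro sum.cong refl)
        (metis complex_norm_square ell2_inner_commute)
    finally show ?thesis by simp
  qed
  have "complex_of_real ((ell2_norm V (f - ?p))\<^sup>2) = ell2_inner V (f - ?p) f"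
    using hp ell2_inner_diff_right[OF f p h] by (simp only: ell2_inner_self[OF h, symmetric]) simp
  also have "\<dots> = of_real ((ell2_norm V f)\<^sup>2 - (\<Sum>b\<in>F. (cmod (ell2_inner V f b))\<^sup>2))"
    by (simp only: ell2_inner_diff_left f p ell2_inner_self pf of_real_diff)
  finally show "(ell2_norm V (f - ?p))\<^sup>2
      = (ell2_norm V f)\<^sup>2 - (\<Sum>b\<in>F. (cmod (ell2_inner V f b))\<^sup>2)"
    unfolding of_real_eq_iff .
qed

lemma Bessel:
  assumes "finite F" "orthonormal V F" "f \<in> ell2 V"
  shows "(\<Sum>b\<in>F. (cmod (ell2_inner V f b))\<^sup>2) \<le> (ell2_norm V f)\<^sup>2"
  using projection_sum_defect(4)[OF assms] zero_le_power2[of "ell2_norm V (f - projection_sum V F f)"]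
  by linarith

text \<open>The defect \<open>h = f - projection_sum V F f\<close> is orthogonal to \<open>F\<close>, hence to the closed span of
  \<open>F\<close>, hence to \<open>f\<close> and to itself.\<close>

lemma Parseval_finite:
  assumes F: "finite F" "orthonormal V F" and f: "f \<in> closed_cspan V F"
  shows "(ell2_norm V f)\<^sup>2 = (\<Sum>b\<in>F. (cmod (ell2_inner V f b))\<^sup>2)"
proof -
  have fV: "f \<in> ell2 V" using f by (simp add: closed_cspan_def)
  note defect = projection_sum_defect[OF F fV]
  define h where "h = f - projection_sum V F f"
  have h: "h \<in> ell2 V" unfolding h_def by (intro ell2_diff fV defect)
  have "F \<subseteq> orth_compl V {h}"
    using defect(2) F(2) ell2_inner_commute[of V _ h]
    by (auto simp: orth_diff_def orthonormal_def h_def[symmetric])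
  then have "f \<in> orth_compl V {h}"
    using closed_cspan_subset_orth_compl[of "{h}" V F] f h by auto
  then have "ell2_inner V h f = 0"
    using ell2_inner_commute[of V h f] by (simp add: orth_diff_def)
  then have "ell2_inner V h h = 0"
    using defect(3) ell2_inner_diff_right[OF fV defect(1) h] by (simp add: h_def[symmetric])
  then have "ell2_norm V h = 0" using h by (simp add: ell2_inner_self)
  then show ?thesis using defect(4) by (simp add: h_def)
qed

text \<open>The double sum \<open>\<Sum>\<^bsub>s,b\<^esub> \<bar>\<langle>s, b\<rangle>\<bar>\<^sup>2\<close> equals the number of the \<open>s\<close> by Parseval and is at most
  the number of the \<open>b\<close> by Bessel.\<close>

lemma orthonormal_card_le:
  assumes B: "finite B" "orthonormal V B" and S: "orthonormal V S" "S \<subseteq> closed_cspan V B"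
  shows "finite S \<and> card S \<le> card B"
proof -
  have le: "card F \<le> card B" if F: "finite F" "F \<subseteq> S" for F
  proof -
    have oF: "orthonormal V F" using S(1) F(2) by (rule orthonormal_mono)
    have "real (card F) = (\<Sum>s\<in>F. (ell2_norm V s)\<^sup>2)"
      by (simp add: orthonormal_norm[OF oF])
    also have "\<dots> = (\<Sum>s\<in>F. \<Sum>b\<in>B. (cmod (ell2_inner V s b))\<^sup>2)"
      using F(2) S(2) by (intro sum.cong refl Parseval_finite B) auto
    also have "\<dots> = (\<Sum>b\<in>B. \<Sum>s\<in>F. (cmod (ell2_inner V b s))\<^sup>2)"
      by (subst sum.swap, intro sum.cong refl) (metis ell2_inner_commute complex_mod_cnj)
    also have "\<dots> \<le> (\<Sum>b\<in>B. (ell2_norm V b)\<^sup>2)"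
      using B(2) by (intro sum_mono Bessel F(1) oF) (auto simp: orthonormal_def)
    also have "\<dots> = real (card B)" by (simp add: orthonormal_norm[OF B(2)])
    finally show ?thesis by simp
  qed
  have "finite S"
  proof (rule ccontr)
    assume "infinite S"
    then obtain F where "F \<subseteq> S" "finite F" "card F = Suc (card B)"
      using infinite_arbitrarily_large by blast
    then show False using le[of F] by simp
  qed
  then show ?thesis using le[of S] by simp
qed

text \<open>By Bessel's inequality for a unit vector, only countably many members of an orthonormal set
  are non-zero at a given vertex.\<close>

lemma orthonormal_countable:
  assumes V: "countable V" and B: "orthonormal V B"
  shows "countable B"
proof -
  have "countable {b \<in> B. b v \<noteq> 0}" if v: "v \<in> V" for v
  proof -
    have "(\<Sum>b\<in>F. (cmod (b v))\<^sup>2) \<le> 1" if F: "F \<subseteq> B" "finite F" for F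
    proof -
      have oF: "orthonormal V F" using B F(1) by (rule orthonormal_mono)
      have "(\<Sum>b\<in>F. (cmod (b v))\<^sup>2) = (\<Sum>b\<in>F. (cmod (ell2_inner V (unit_fun v) b))\<^sup>2)"
        by (subst ell2_inner_commute) (simp add: ell2_inner_unit_right[OF v])
      also have "\<dots> \<le> 1"
        using Bessel[OF F(2) oF ell2_unit[OF v]] by (simp add: ell2_norm_unit[OF v])
      finally show ?thesis .
    qed
    then have "(\<lambda>b. (cmod (b v))\<^sup>2) summable_on B"
      by (intro nonneg_bdd_above_summable_on bdd_aboveI[of _ 1]) auto
    then have "countable {b \<in> B. (cmod (b v))\<^sup>2 \<noteq> 0}"
      using abs_summable_countable[of "\<lambda>b. (cmod (b v))\<^sup>2" B] by simp
    then show ?thesis by simp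
  qed
  moreover have "B \<subseteq> (\<Union>v\<in>V. {b \<in> B. b v \<noteq> 0})"
  proof
    fix b assume b: "b \<in> B"
    then have "b \<noteq> 0" using orthonormal_norm[OF B b] by auto
    then obtain v where "b v \<noteq> 0" by (auto simp: fun_eq_iff)
    moreover have "v \<in> V"
      using B b \<open>b v \<noteq> 0\<close> ell2_vanish[of b V v] by (auto simp: orthonormal_def)
    ultimately show "b \<in> (\<Union>v\<in>V. {b \<in> B. b v \<noteq> 0})" using b by auto
  qed
  ultimately show ?thesis using V by (meson countable_UN countable_subset)
qed

text \<open>In the finite case the preceding bound applies in both directions; otherwise both bases are
  countably infinite. This makes the choice of a basis in \<^const>\<open>hilbert_dim\<close> irrelevant.\<close>

lemma orthonormal_bases_equipotent:
  assumes V: "countable V" and B: "orthonormal_basis V M B" and C: "orthonormal_basis V M C"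
  shows "|B| =o |C|"
proof (cases "finite B")
  case True
  have on: "orthonormal V B" "orthonormal V C" and cl: "closed_cspan V B = M" "closed_cspan V C = M"
    using B C by (auto simp: orthonormal_basis_iff)
  have sub: "B \<subseteq> M" "C \<subseteq> M"
    using closed_cspan_superset[of B V] closed_cspan_superset[of C V] on cl
    by (auto simp: orthonormal_def)
  have "finite C \<and> card C \<le> card B"
    using orthonormal_card_le[OF True on(1) on(2)] sub cl by simp
  moreover from this have "finite B \<and> card B \<le> card C"
    using orthonormal_card_le[OF _ on(2) on(1)] sub cl by simp
  ultimately have "\<exists>f. bij_betw f B C" by (intro finite_same_card_bij) auto
  then show ?thesis using card_of_ordIso by blast
next
  case False
  have on: "orthonormal V B" "orthonormal V C" and cl: "closed_cspan V B = M" "closed_cspan V C = M"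
    using B C by (auto simp: orthonormal_basis_iff)
  have sub: "B \<subseteq> M"
    using closed_cspan_superset[of B V] on cl by (auto simp: orthonormal_def)
  have "infinite C"
    using orthonormal_card_le[OF _ on(2) on(1)] sub cl False by auto
  moreover have "countable B" "countable C"
    using orthonormal_countable[OF V] on by auto
  ultimately have "\<exists>f. bij_betw f B C"
    using False by (meson bij_betw_inv bij_betw_trans countableE_infinite)
  then show ?thesis using card_of_ordIso by blast
qed

lemma hilbert_dim_eq:
  assumes "countable V" "orthonormal_basis V M B"
  shows "hilbert_dim V M =o |B|"
  unfolding hilbert_dim_def
  using orthonormal_bases_equipotent[OF assms(1) someI[of "orthonormal_basis V M", OF assms(2)] assms(2)] .

lemma inj_unit_fun: "inj_on unit_fun S"
  by (rule inj_onI) (metis unit_fun_apply zero_neq_one)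

lemma unit_orthonormal_basis:
  assumes "S \<subseteq> V"
  shows "orthonormal_basis V (ell2 S) (unit_fun ` S)"
  unfolding orthonormal_basis_def cspan_unit_dense[OF assms]
proof (intro conjI ballI refl)
  show "unit_fun ` S \<subseteq> ell2 V" using assms by (auto intro: ell2_unit)
  fix f g assume "f \<in> unit_fun ` S" "g \<in> unit_fun ` S"
  then obtain v w where "f = unit_fun v" "v \<in> S" "g = unit_fun w" "w \<in> S" by blast
  then show "ell2_inner V f g = (if f = g then 1 else 0)"
    using assms inj_onD[OF inj_unit_fun, of v w S]
    by (auto simp: ell2_inner_unit_right subset_iff)
qed

lemma card_unit_funs: "|unit_fun ` S| =o |S|"
  using card_of_ordIso[of S "unit_fun ` S"] inj_on_imp_bij_betw[OF inj_unit_fun[of S]] ordIso_symmetric by blast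

section \<open>Reflections\<close>

text \<open>The Householder reflection in the hyperplane orthogonal to \<open>w\<close>. For \<open>w = 0\<close> it is the identity.\<close>

definition reflection :: "'v set \<Rightarrow> ('v \<Rightarrow> complex) \<Rightarrow> ('v \<Rightarrow> complex) \<Rightarrow> 'v \<Rightarrow> complex" where
  "reflection V w f = f - scaleF (2 * ell2_inner V f w / ell2_inner V w w) w"

context
  fixes V :: "'v set" and w :: "'v \<Rightarrow> complex"
  assumes w: "w \<in> ell2 V"
begin

lemma reflection_ell2: "f \<in> ell2 V \<Longrightarrow> reflection V w f \<in> ell2 V"
  unfolding reflection_def by (intro ell2_diff ell2_scale w)

lemma reflection_zero: "reflection V w 0 = 0"
  by (auto simp: reflection_def fun_eq_iff)

lemma reflection_add:
  "f \<in> ell2 V \<Longrightarrow> g \<in> ell2 V \<Longrightarrow> reflection V w (f + g) = reflection V w f + reflection V w g"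
  by (rule ext) (simp add: reflection_def ell2_inner_add_left w distrib_left distrib_right
      add_divide_distrib)

lemma reflection_scale: "reflection V w (scaleF c f) = scaleF c (reflection V w f)"
  by (rule ext) (simp add: reflection_def ell2_inner_scale_left algebra_simps)

lemma reflection_diff:
  assumes "f \<in> ell2 V" "g \<in> ell2 V"
  shows "reflection V w (f - g) = reflection V w f - reflection V w g"
  unfolding diff_conv_scaleF by (simp add: reflection_add reflection_scale ell2_scale assms)

lemma reflection_self_adjoint:
  assumes "f \<in> ell2 V" "g \<in> ell2 V"
  shows "ell2_inner V (reflection V w f) g = ell2_inner V f (reflection V w g)"
proof -
  have "cnj (ell2_inner V w w) = ell2_inner V w w" by (rule ell2_inner_commute[symmetric])
  then show ?thesis
    using assms w
    by (simp add: reflection_def ell2_inner_diff_left ell2_inner_diff_right ell2_scale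
        ell2_inner_scale_left ell2_inner_scale_right ell2_inner_commute[of V w g])
qed

lemma reflection_involution:
  assumes "f \<in> ell2 V"
  shows "reflection V w (reflection V w f) = f"
proof (cases "ell2_inner V w w = 0")
  case True
  then show ?thesis by (auto simp: reflection_def fun_eq_iff)
next
  case False
  have "ell2_inner V (reflection V w f) w = - ell2_inner V f w"
    unfolding reflection_def using False
    by (simp add: ell2_inner_diff_left ell2_scale w assms ell2_inner_scale_left)
  then show ?thesis
    by (subst reflection_def) (auto simp: reflection_def fun_eq_iff)
qed

lemma reflection_inner:
  assumes "f \<in> ell2 V" "g \<in> ell2 V"
  shows "ell2_inner V (reflection V w f) (reflection V w g) = ell2_inner V f g"
  by (simp add: reflection_self_adjoint assms reflection_ell2 reflection_involution)

lemma reflection_norm: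
  assumes "f \<in> ell2 V"
  shows "ell2_norm V (reflection V w f) = ell2_norm V f"
proof -
  have "complex_of_real ((ell2_norm V (reflection V w f))\<^sup>2) = of_real ((ell2_norm V f)\<^sup>2)"
    using reflection_inner[OF assms assms]
    by (simp only: ell2_inner_self assms reflection_ell2)
  then show ?thesis unfolding of_real_eq_iff by (rule power2_eq_imp_eq) auto
qed

lemma reflection_inj: "inj_on (reflection V w) (ell2 V)"
  by (rule inj_on_inverseI) (rule reflection_involution)

lemma reflection_closed_cspan_subset:
  assumes B: "B \<subseteq> ell2 V"
  shows "reflection V w ` closed_cspan V B \<subseteq> closed_cspan V (reflection V w ` B)"
proof -
  have span: "cspan B \<subseteq> {g \<in> ell2 V. reflection V w g \<in> cspan (reflection V w ` B)}"
    using B cspan_base[of _ "reflection V w ` B"]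
    by (intro cspan_least)
      (auto simp: ell2_add ell2_scale reflection_add reflection_scale reflection_zero
        cspan_add cspan_scale cspan_zero)
  show ?thesis
  proof (rule image_subsetI)
    fix f assume f: "f \<in> closed_cspan V B"
    then have fV: "f \<in> ell2 V" by (simp add: closed_cspan_def)
    have "\<exists>g\<in>cspan (reflection V w ` B). ell2_norm V (reflection V w f - g) < \<epsilon>"
      if pos: "\<epsilon> > 0" for \<epsilon>
    proof -
      obtain g where g: "g \<in> cspan B" "ell2_norm V (f - g) < \<epsilon>"
        using f pos unfolding closed_cspan_def by blast
      then have "g \<in> ell2 V" "reflection V w g \<in> cspan (reflection V w ` B)"
        using span by auto
      then show ?thesis
        using g(2) fV by (intro bexI[of _ "reflection V w g"])
          (simp_all add: reflection_diff[symmetric] reflection_norm ell2_diff)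
    qed
    then show "reflection V w f \<in> closed_cspan V (reflection V w ` B)"
      using reflection_ell2[OF fV] by (simp add: closed_cspan_def)
  qed
qed

text \<open>Reflections are unitary, so they transport orthonormal bases.\<close>

lemma reflection_orthonormal_basis:
  assumes B: "orthonormal_basis V M B"
  shows "orthonormal_basis V (reflection V w ` M) (reflection V w ` B)"
proof -
  let ?H = "reflection V w"
  have BV: "B \<subseteq> ell2 V" and M: "closed_cspan V B = M"
    using B by (auto simp: orthonormal_basis_def)
  have HB: "?H ` B \<subseteq> ell2 V" using BV by (auto intro: reflection_ell2)
  have HHB: "?H ` ?H ` B = B" using BV by (force simp: image_image reflection_involution)
  have "closed_cspan V (?H ` B) = ?H ` M"
  proof
    show "?H ` M \<subseteq> closed_cspan V (?H ` B)"
      using reflection_closed_cspan_subset[OF BV] M by simp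
    show "closed_cspan V (?H ` B) \<subseteq> ?H ` M"
    proof
      fix f assume f: "f \<in> closed_cspan V (?H ` B)"
      then have "?H f \<in> M"
        using reflection_closed_cspan_subset[OF HB] M HHB by auto
      moreover have "f = ?H (?H f)"
        using f by (simp add: reflection_involution closed_cspan_def)
      ultimately show "f \<in> ?H ` M" by blast
    qed
  qed
  moreover have "orthonormal V (?H ` B)"
    using B BV HB inj_onD[OF reflection_inj] unfolding orthonormal_basis_iff orthonormal_def
    by (auto simp: reflection_inner subset_iff)
  ultimately show ?thesis by (simp add: orthonormal_basis_iff)
qed

end

text \<open>The reflection exchanging the unit vectors \<open>x = e / \<parallel>e\<parallel>\<close> and \<open>y = \<omega> unit_fun u\<close> maps the
  functions vanishing at \<open>u\<close> onto those orthogonal to \<open>e\<close>. The phase \<open>\<omega>\<close> makes \<open>\<langle>x, y\<rangle>\<close> real;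
  otherwise no reflection exchanges \<open>x\<close> and \<open>y\<close>.\<close>

lemma orth_vector_orthonormal_basis:
  assumes TV: "T \<subseteq> V" and e: "e \<in> ell2 T" "e \<noteq> 0" and u: "u \<in> T"
  obtains B where "orthonormal_basis V (orth_diff V (ell2 T) {e}) B" "|B| =o |T - {u}|"
proof -
  define n where "n = ell2_norm V e"
  have eV: "e \<in> ell2 V" and uV: "u \<in> V" using e u TV by (auto simp: ell2_subset_iff)
  have n: "n > 0"
    using ell2_norm_eq_0_iff[OF eV] e(2) ell2_norm_nonneg[of V e] unfolding n_def by linarith
  define x where "x = scaleF (1 / n) e"
  define \<omega> where "\<omega> = (if x u = 0 then 1 else sgn (x u))"
  define y where "y = scaleF \<omega> (unit_fun u)"
  define w where "w = x - y"
  let ?H = "reflection V w"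
  have "cmod \<omega> = 1" by (simp add: \<omega>_def norm_sgn)
  then have \<omega>\<omega>: "\<omega> * cnj \<omega> = 1" by (simp add: complex_norm_square[symmetric])
  have "x u = of_real (cmod (x u)) * \<omega>" by (simp add: \<omega>_def sgn_eq)
  then have "x u * cnj \<omega> = of_real (cmod (x u)) * (\<omega> * cnj \<omega>)"
    by (metis mult.assoc)
  with \<omega>\<omega> have \<omega>: "\<omega> * cnj \<omega> = 1" "x u * cnj \<omega> = of_real (cmod (x u))" by simp_all
  have xT: "x \<in> ell2 T" "y \<in> ell2 T" "w \<in> ell2 T"
    unfolding x_def y_def w_def by (intro ell2_diff ell2_scale ell2_unit e u)+
  then have V: "x \<in> ell2 V" "y \<in> ell2 V" "w \<in> ell2 V" using TV by (auto simp: ell2_subset_iff)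
  have xx: "ell2_inner V x x = 1"
    using n unfolding x_def
    by (simp add: ell2_inner_scale_left ell2_inner_scale_right ell2_inner_self eV power2_eq_square
        flip: n_def)
  have inner_y: "ell2_inner V f y = cnj \<omega> * f u" for f
    unfolding y_def by (simp add: ell2_inner_scale_right ell2_inner_unit_right uV)
  have xy: "ell2_inner V x y = of_real (cmod (x u))"
    unfolding inner_y using \<omega>(2) by (simp add: mult.commute)
  have yx: "ell2_inner V y x = of_real (cmod (x u))"
    by (subst ell2_inner_commute) (simp add: xy)
  have yy: "ell2_inner V y y = 1"
    unfolding inner_y using \<omega>(1) by (simp add: y_def mult.commute)
  have Hx: "?H x = y"
  proof (cases "w = 0")
    case True
    then show ?thesis by (auto simp: reflection_def w_def fun_eq_iff)
  next
    case False
    have ww: "ell2_inner V w w = 2 * (1 - of_real (cmod (x u)))"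
      unfolding w_def
      by (simp add: ell2_inner_diff_left ell2_inner_diff_right ell2_diff V xx xy yx yy)
    have "ell2_inner V w w \<noteq> 0"
      using False V(3) by (simp add: ell2_inner_self ell2_norm_eq_0_iff)
    then have "2 * ell2_inner V x w / ell2_inner V w w = 1"
      unfolding ww unfolding w_def by (simp add: ell2_inner_diff_right V xx xy)
    then show ?thesis by (auto simp: reflection_def w_def fun_eq_iff)
  qed
  have Hy: "?H y = x" using reflection_involution[OF V(3) V(1)] Hx by simp
  have HT: "?H f \<in> ell2 T" if "f \<in> ell2 T" for f
    unfolding reflection_def by (intro ell2_diff ell2_scale that xT)
  have inner_e: "ell2_inner V f e = of_real n * ell2_inner V f x" for f
    using n by (simp add: x_def ell2_inner_scale_right)
  have image: "?H ` ell2 (T - {u}) = orth_diff V (ell2 T) {e}"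
  proof
    show "?H ` ell2 (T - {u}) \<subseteq> orth_diff V (ell2 T) {e}"
    proof (rule image_subsetI)
      fix f assume f: "f \<in> ell2 (T - {u})"
      have fT: "f \<in> ell2 T" "f u = 0" using f by (auto simp: ell2_subset_iff[of "T - {u}" T])
      then have fV: "f \<in> ell2 V" using TV by (auto simp: ell2_subset_iff)
      have "ell2_inner V (?H f) x = ell2_inner V f y"
        by (simp add: reflection_self_adjoint V fV Hx)
      then show "?H f \<in> orth_diff V (ell2 T) {e}"
        using HT[OF fT(1)] fT(2) by (simp add: orth_diff_def inner_e inner_y)
    qed
    show "orth_diff V (ell2 T) {e} \<subseteq> ?H ` ell2 (T - {u})"
    proof
      fix f assume f: "f \<in> orth_diff V (ell2 T) {e}"
      then have fT: "f \<in> ell2 T" and fx: "ell2_inner V f x = 0"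
        using n by (auto simp: orth_diff_def inner_e)
      then have fV: "f \<in> ell2 V" using TV by (auto simp: ell2_subset_iff)
      have "ell2_inner V (?H f) y = 0"
        by (simp add: reflection_self_adjoint V fV Hy fx)
      then have "?H f u = 0" using \<omega>(1) unfolding inner_y by auto
      then have "?H f \<in> ell2 (T - {u})"
        using HT[OF fT] by (auto simp: ell2_subset_iff[of "T - {u}" T] ell2_vanish)
      moreover have "f = ?H (?H f)" by (simp add: reflection_involution V fV)
      ultimately show "f \<in> ?H ` ell2 (T - {u})" by blast
    qed
  qed
  have sub: "T - {u} \<subseteq> V" using TV by auto
  have "orthonormal_basis V (orth_diff V (ell2 T) {e}) (?H ` unit_fun ` (T - {u}))"
    using reflection_orthonormal_basis[OF V(3) unit_orthonormal_basis[OF sub]] by (simp only: image)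
  moreover have "|?H ` unit_fun ` (T - {u})| =o |T - {u}|"
  proof -
    have "unit_fun ` (T - {u}) \<subseteq> ell2 V" using sub by (auto intro: ell2_unit)
    then have "bij_betw ?H (unit_fun ` (T - {u})) (?H ` unit_fun ` (T - {u}))"
      by (intro inj_on_imp_bij_betw inj_on_subset[OF reflection_inj[OF V(3)]])
    then have "|unit_fun ` (T - {u})| =o |?H ` unit_fun ` (T - {u})|"
      using card_of_ordIso by blast
    then show ?thesis using card_unit_funs ordIso_symmetric ordIso_transitive by blast
  qed
  ultimately show ?thesis using that by blast
qed

section \<open>Orthogonal sums\<close>

lemma orth_diff_cspan_singleton: "orth_diff V M (cspan {e}) = orth_diff V M {e}"
proof -
  have "(\<forall>g\<in>cspan {e}. ell2_inner V f g = 0) \<longleftrightarrow> ell2_inner V f e = 0" for f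
    using cspan_base[of e "{e}"] by (auto simp: cspan_singleton ell2_inner_scale_right)
  then show ?thesis by (simp add: orth_diff_def)
qed

lemma ell2_restrict:
  assumes "f \<in> ell2 V"
  shows "(\<lambda>v. if v \<in> S then f v else 0) \<in> ell2 (V \<inter> S)"
proof -
  have "(\<lambda>v. if v \<in> S then f v else 0) \<in> ell2 V"
    by (rule ell2_dominated[OF assms, where K = 1]) (auto simp: ell2_vanish[OF assms])
  then show ?thesis
    using ell2_vanish[OF assms] by (auto simp: ell2_subset_iff[of "V \<inter> S" V])
qed

lemma orth_diff_ell2:
  assumes "U \<subseteq> V"
  shows "orth_diff V (ell2 V) (ell2 U) = ell2 (V - U)"
proof
  show "orth_diff V (ell2 V) (ell2 U) \<subseteq> ell2 (V - U)"
  proof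
    fix f assume f: "f \<in> orth_diff V (ell2 V) (ell2 U)"
    then have fV: "f \<in> ell2 V" by (simp add: orth_diff_def)
    have "f v = 0" if "v \<in> U" for v
      using f that assms ell2_unit[OF that] ell2_inner_unit_right[of v V f]
      by (auto simp: orth_diff_def)
    then show "f \<in> ell2 (V - U)"
      using fV by (auto simp: ell2_subset_iff[of "V - U" V] ell2_vanish)
  qed
  show "ell2 (V - U) \<subseteq> orth_diff V (ell2 V) (ell2 U)"
  proof
    fix f assume f: "f \<in> ell2 (V - U)"
    then have "f \<in> ell2 V" by (simp add: ell2_subset_iff[of "V - U" V])
    moreover have "ell2_inner V f g = 0" if "g \<in> ell2 U" for g
      using ell2_vanish[OF f] ell2_vanish[OF that] by (intro ell2_inner_disjoint) auto
    ultimately show "f \<in> orth_diff V (ell2 V) (ell2 U)" by (simp add: orth_diff_def)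
  qed
qed

lemma ell2_insert_orth_sum:
  assumes "S \<subseteq> V" "u \<in> V" "u \<notin> S"
  shows "is_orth_sum V (ell2 (insert u S)) (ell2 S) (cspan {unit_fun u})"
  unfolding is_orth_sum_def
proof (intro conjI ballI)
  fix f g assume "f \<in> ell2 S" "g \<in> cspan {unit_fun u}"
  then show "ell2_inner V f g = 0"
    using assms(3) ell2_vanish[of f S u]
    by (intro ell2_inner_disjoint) (auto simp: cspan_singleton split: if_splits)
next
  have iS: "insert u S \<subseteq> V" using assms by auto
  show "ell2 (insert u S) = {f + g |f g. f \<in> ell2 S \<and> g \<in> cspan {unit_fun u}}"
  proof (intro equalityI subsetI)
    fix f assume f: "f \<in> ell2 (insert u S)"
    have "f = (\<lambda>v. if v \<in> S then f v else 0) + scaleF (f u) (unit_fun u)"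
      using assms(3) ell2_vanish[OF f] by (auto simp: fun_eq_iff)
    moreover have "(\<lambda>v. if v \<in> S then f v else 0) \<in> ell2 S"
      using ell2_restrict[OF f, of S] by (simp add: Int_absorb1 subset_insertI)
    moreover have "scaleF (f u) (unit_fun u) \<in> cspan {unit_fun u}"
      by (auto simp: cspan_singleton)
    ultimately show "f \<in> {f + g |f g. f \<in> ell2 S \<and> g \<in> cspan {unit_fun u}}" by blast
  next
    fix h assume "h \<in> {f + g |f g. f \<in> ell2 S \<and> g \<in> cspan {unit_fun u}}"
    then obtain f c where h: "f \<in> ell2 S" "h = f + scaleF c (unit_fun u)"
      by (auto simp: cspan_singleton)
    have "f \<in> ell2 (insert u S)" using h(1) by (simp add: ell2_subset_iff[OF subset_insertI[of S u]])
    then show "h \<in> ell2 (insert u S)"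
      unfolding h(2) by (intro ell2_add ell2_scale ell2_unit) auto
  qed
qed

lemma orth_diff_vector_orth_sum:
  assumes T: "T \<subseteq> V" "R \<subseteq> V" "T \<inter> R = {}" and e: "e \<in> ell2 R"
  shows "is_orth_sum V (orth_diff V (ell2 (T \<union> R)) {e}) (ell2 T) (orth_diff V (ell2 R) {e})"
  unfolding is_orth_sum_def
proof (intro conjI ballI)
  have Te: "ell2_inner V f g = 0" if "f \<in> ell2 T" "g \<in> ell2 R" for f g
    using T(3) ell2_vanish[OF that(1)] ell2_vanish[OF that(2)] by (intro ell2_inner_disjoint) auto
  then show "ell2_inner V f g = 0" if "f \<in> ell2 T" "g \<in> orth_diff V (ell2 R) {e}" for f g
    using that by (simp add: orth_diff_def)
  have eV: "e \<in> ell2 V" using e T by (simp add: ell2_subset_iff)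
  show "orth_diff V (ell2 (T \<union> R)) {e} = {f + g |f g. f \<in> ell2 T \<and> g \<in> orth_diff V (ell2 R) {e}}"
  proof (intro equalityI subsetI)
    fix h assume h: "h \<in> orth_diff V (ell2 (T \<union> R)) {e}"
    then have hTR: "h \<in> ell2 (T \<union> R)" and he: "ell2_inner V h e = 0" by (auto simp: orth_diff_def)
    define f g where "f = (\<lambda>v. if v \<in> T then h v else 0)" and "g = (\<lambda>v. if v \<in> R then h v else 0)"
    have f: "f \<in> ell2 T" and g: "g \<in> ell2 R"
      using ell2_restrict[OF hTR, of T] ell2_restrict[OF hTR, of R]
      by (simp_all add: f_def g_def Int_absorb1)
    have hfg: "h = f + g"
      using T(3) ell2_vanish[OF hTR] by (auto simp: fun_eq_iff f_def g_def)
    have "f \<in> ell2 V" "g \<in> ell2 V" using f g T by (auto simp: ell2_subset_iff)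
    then have "ell2_inner V g e = 0"
      using he Te[OF f e] by (simp add: hfg ell2_inner_add_left eV)
    then show "h \<in> {f + g |f g. f \<in> ell2 T \<and> g \<in> orth_diff V (ell2 R) {e}}"
      using hfg f g by (auto simp: orth_diff_def)
  next
    fix h assume "h \<in> {f + g |f g. f \<in> ell2 T \<and> g \<in> orth_diff V (ell2 R) {e}}"
    then obtain f g where f: "f \<in> ell2 T" and g: "g \<in> ell2 R" and ge: "ell2_inner V g e = 0"
      and h: "h = f + g" by (auto simp: orth_diff_def)
    have V: "f \<in> ell2 V" "g \<in> ell2 V" using f g T by (auto simp: ell2_subset_iff)
    have "f \<in> ell2 (T \<union> R)" "g \<in> ell2 (T \<union> R)"
      using f g by (auto simp: ell2_subset_iff[of T "T \<union> R"] ell2_subset_iff[of R "T \<union> R"])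
    then show "h \<in> orth_diff V (ell2 (T \<union> R)) {e}"
      using Te[OF f e] ge V by (simp add: h orth_diff_def ell2_add ell2_inner_add_left eV)
  qed
qed

lemma orth_vector_orth_sum:
  assumes T: "T \<subseteq> V" and e: "e \<in> ell2 T"
  shows "is_orth_sum V (ell2 T) (orth_diff V (ell2 T) {e}) (cspan {e})"
  unfolding is_orth_sum_def
proof (intro conjI ballI)
  show "ell2_inner V f g = 0" if "f \<in> orth_diff V (ell2 T) {e}" "g \<in> cspan {e}" for f g
    using that by (auto simp: orth_diff_def cspan_singleton ell2_inner_scale_right)
  have eV: "e \<in> ell2 V" using e T by (simp add: ell2_subset_iff)
  show "ell2 T = {f + g |f g. f \<in> orth_diff V (ell2 T) {e} \<and> g \<in> cspan {e}}"
  proof (intro equalityI subsetI)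
    fix h assume h: "h \<in> ell2 T"
    then have hV: "h \<in> ell2 V" using T by (simp add: ell2_subset_iff)
    \<comment> \<open>For \<open>e = 0\<close> the quotient is \<open>0\<close> by the convention on division.\<close>
    define c where "c = ell2_inner V h e / ell2_inner V e e"
    have "e = 0" if "ell2_inner V e e = 0"
      using that eV by (simp add: ell2_inner_self ell2_norm_eq_0_iff)
    then have "ell2_inner V (h - scaleF c e) e = 0"
      by (cases "ell2_inner V e e = 0")
        (simp_all add: c_def ell2_inner_diff_left ell2_scale hV eV ell2_inner_scale_left)
    then have "h - scaleF c e \<in> orth_diff V (ell2 T) {e}"
      using h e by (simp add: orth_diff_def ell2_diff ell2_scale)
    moreover have "h = (h - scaleF c e) + scaleF c e" by simp
    ultimately show "h \<in> {f + g |f g. f \<in> orth_diff V (ell2 T) {e} \<and> g \<in> cspan {e}}"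
      unfolding cspan_singleton by blast
  next
    fix h assume "h \<in> {f + g |f g. f \<in> orth_diff V (ell2 T) {e} \<and> g \<in> cspan {e}}"
    then show "h \<in> ell2 T"
      using e by (auto simp: orth_diff_def cspan_singleton ell2_add ell2_scale)
  qed
qed

section \<open>The orthogonal sum of a diagonal and a rank one operator\<close>

text \<open>The operator acts as the diagonal operator with entries \<open>c v\<close> on \<open>\<ell>\<^sup>2(U)\<close>; on the complement of
  \<open>U\<close> it is the rank one operator sending \<open>f\<close> to \<open>\<langle>f, wvec\<rangle>\<close> times the unit vector at \<open>u\<close>. The weight
  vector \<open>wvec\<close> is supported in the finite set \<open>A\<close>.\<close>

locale diag_rank_one =
  fixes V U A :: "'v set" and u :: 'v and c :: "'v \<Rightarrow> complex"
  assumes countable_V: "countable V"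
    and U_V: "U \<subseteq> V" and A_V: "A \<subseteq> V" and fin_A: "finite A"
    and disj: "A \<inter> U = {}" and u_A: "u \<in> A" and A_nontrivial: "\<exists>b\<in>A. b \<noteq> u"
begin

definition act :: "('v \<Rightarrow> complex) \<Rightarrow> 'v \<Rightarrow> complex" where
  "act f = (\<lambda>w. if w \<in> U then c w * f w else if w = u then (\<Sum>v\<in>A. c v * f v) else 0)"

definition Op :: "'v operator" where
  "Op = Operator {f \<in> ell2 V. act f \<in> ell2 V} act"

definition wvec :: "'v \<Rightarrow> complex" where
  "wvec = (\<lambda>v. if v \<in> A then cnj (c v) else 0)"

definition level :: "complex \<Rightarrow> 'v set" where
  "level \<mu> = {v \<in> insert u U. c v = \<mu>}"

text \<open>The vertices that carry the kernel: a vector killed by the diagonal part is supported here.\<close>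

definition null_verts :: "'v set" where
  "null_verts = {v \<in> V. v \<in> U \<longrightarrow> c v = 0}"

lemma u_V: "u \<in> V" and u_notin_U: "u \<notin> U"
  using u_A A_V disj by auto

lemma level_V: "level \<mu> \<subseteq> V"
  using u_V U_V by (auto simp: level_def)

lemma null_verts_V: "null_verts \<subseteq> V"
  by (auto simp: null_verts_def)

lemma A_null_verts: "A \<subseteq> null_verts"
  using A_V disj by (auto simp: null_verts_def)

lemma null_verts_Un: "null_verts = {v \<in> U. c v = 0} \<union> (V - U)"
  using U_V by (auto simp: null_verts_def)

lemma wvec_ell2: "A \<subseteq> S \<Longrightarrow> wvec \<in> ell2 S"
  by (rule ell2_finite_support[OF fin_A]) (auto simp: wvec_def)

lemma inner_wvec: "ell2_inner V f wvec = (\<Sum>v\<in>A. c v * f v)"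
  by (subst ell2_inner_finite_support[OF fin_A A_V]) (auto simp: wvec_def mult.commute)

lemma act_u: "act f u = ell2_inner V f wvec"
  using u_notin_U by (simp add: act_def inner_wvec)

lemma act_u_single:
  assumes "\<And>v. v \<in> A \<Longrightarrow> v \<noteq> u \<Longrightarrow> f v = 0"
  shows "act f u = c u * f u"
proof -
  have "(\<Sum>v\<in>A. c v * f v) = (\<Sum>v\<in>{u}. c v * f v)"
    using u_A fin_A assms by (intro sum.mono_neutral_right) auto
  then show ?thesis using u_notin_U by (simp add: act_def)
qed

lemma act_diff: "act (f - g) = act f - act g"
  by (auto simp: act_def fun_eq_iff algebra_simps sum_subtractf)

lemma Op_dom: "op_dom Op = {f \<in> ell2 V. act f \<in> ell2 V}" and Op_app: "op_app Op = act"
  by (simp_all add: Op_def)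

text \<open>The range of the operator is supported in \<open>insert u U\<close>, hence so is an eigenvector for
  \<open>\<mu> \<noteq> 0\<close>. As \<open>u\<close> is the only vertex of \<open>A\<close> in that set, the rank one part acts on such a vector
  as multiplication by \<open>c u\<close> at \<open>u\<close>, like one more diagonal entry.\<close>

lemma eigenspace_nonzero:
  assumes "\<mu> \<noteq> 0"
  shows "eigenspace Op \<mu> = ell2 (level \<mu>)"
proof (intro equalityI subsetI)
  fix f assume "f \<in> eigenspace Op \<mu>"
  then have fV: "f \<in> ell2 V" and eq: "\<And>w. act f w = \<mu> * f w"
    by (auto simp: eigenspace_def Op_dom Op_app fun_eq_iff)
  have off: "f w = 0" if "w \<notin> insert u U" for w
    using eq[of w] that assms by (simp add: act_def)
  have "act f u = c u * f u" using disj off by (intro act_u_single) auto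
  then have "f u = 0" if "c u \<noteq> \<mu>" using that eq[of u] by simp
  moreover have "f w = 0" if "w \<in> U" "c w \<noteq> \<mu>" for w
    using that eq[of w] by (simp add: act_def)
  ultimately have "f v = 0" if "v \<notin> level \<mu>" for v
    using off[of v] that by (cases "v = u"; cases "v \<in> U") (auto simp: level_def)
  then show "f \<in> ell2 (level \<mu>)" by (simp add: ell2_subset_iff[OF level_V] fV)
next
  fix f assume f: "f \<in> ell2 (level \<mu>)"
  then have fV: "f \<in> ell2 V" and off: "\<And>w. w \<notin> level \<mu> \<Longrightarrow> f w = 0"
    by (auto simp: ell2_subset_iff[OF level_V])
  have fu: "act f u = c u * f u" using disj off by (intro act_u_single) (auto simp: level_def)
  have eq: "act f = scaleF \<mu> f"
  proof
    fix w
    show "act f w = scaleF \<mu> f w"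
      using off[of w] fu by (cases "w = u") (auto simp: act_def level_def)
  qed
  then show "f \<in> eigenspace Op \<mu>"
    using fV by (simp add: eigenspace_def Op_dom Op_app ell2_scale)
qed

lemma act_eq_0_iff: "act f = 0 \<longleftrightarrow> (\<forall>v\<in>U. c v = 0 \<or> f v = 0) \<and> ell2_inner V f wvec = 0"
proof -
  have "act f = 0 \<longleftrightarrow> (\<forall>w\<in>U. act f w = 0) \<and> act f u = 0"
    by (auto simp: fun_eq_iff act_def)
  then show ?thesis by (simp add: act_u) (simp add: act_def)
qed

lemma ell2_null_verts_iff: "f \<in> ell2 null_verts \<longleftrightarrow> f \<in> ell2 V \<and> (\<forall>v\<in>U. c v = 0 \<or> f v = 0)"
  unfolding ell2_subset_iff[OF null_verts_V] using U_V
  by (auto simp: null_verts_def ell2_vanish)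

lemma eigenspace_zero: "eigenspace Op 0 = orth_diff V (ell2 null_verts) {wvec}"
proof -
  have "scaleF 0 f = 0" for f :: "'v \<Rightarrow> complex" by auto
  then have "eigenspace Op 0 = {f \<in> ell2 V. act f = 0}"
    by (auto simp: eigenspace_def Op_dom Op_app)
  then show ?thesis
    by (auto simp: act_eq_0_iff orth_diff_def ell2_null_verts_iff)
qed

text \<open>The value \<open>0\<close> is always an eigenvalue because \<open>A\<close> has at least two elements, so that some
  non-zero function supported in \<open>A\<close> is orthogonal to the weight vector.\<close>

lemma zero_eigenvalue: "0 \<in> point_spectrum Op"
proof -
  obtain b where b: "b \<in> A" "b \<noteq> u" using A_nontrivial by blast
  define f where "f = (if c b = 0 then unit_fun b
    else scaleF (c b) (unit_fun u) - scaleF (c u) (unit_fun b))"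
  have fV: "f \<in> ell2 null_verts"
    using A_null_verts b(1) u_A unfolding f_def
    by (auto intro!: ell2_diff ell2_scale ell2_unit)
  have "(\<Sum>v\<in>A. c v * f v) = (\<Sum>v\<in>{u, b}. c v * f v)"
    using u_A b fin_A by (intro sum.mono_neutral_right) (auto simp: f_def)
  also have "\<dots> = 0" using b(2) by (auto simp: f_def)
  finally have "f \<in> eigenspace Op 0"
    using fV by (simp add: eigenspace_zero orth_diff_def inner_wvec)
  moreover have "f \<noteq> 0"
  proof -
    have "f (if c b = 0 then b else u) \<noteq> 0" using b(2) by (simp add: f_def)
    then show ?thesis by auto
  qed
  ultimately show ?thesis by (auto simp: point_spectrum_def)
qed

lemma point_spectrum_Op: "point_spectrum Op = insert 0 (c ` insert u U)"
proof -
  have "\<mu> \<in> point_spectrum Op \<longleftrightarrow> \<mu> \<in> c ` insert u U" if nz: "\<mu> \<noteq> 0" for \<mu>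
  proof
    assume "\<mu> \<in> point_spectrum Op"
    then obtain f where f: "f \<in> ell2 (level \<mu>)" "f \<noteq> 0"
      unfolding point_spectrum_def using eigenspace_nonzero[OF nz] by blast
    then have "level \<mu> \<noteq> {}" using ell2_vanish[OF f(1)] by (auto simp: fun_eq_iff)
    then show "\<mu> \<in> c ` insert u U" by (auto simp: level_def)
  next
    assume "\<mu> \<in> c ` insert u U"
    then obtain v where "v \<in> level \<mu>" by (auto simp: level_def)
    then have "unit_fun v \<in> eigenspace Op \<mu>"
      by (simp add: eigenspace_nonzero[OF nz] ell2_unit)
    moreover have "unit_fun v \<noteq> 0" by (metis unit_fun_apply zero_fun_apply zero_neq_one)
    ultimately show "\<mu> \<in> point_spectrum Op" unfolding point_spectrum_def by (intro CollectI bexI)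
  qed
  then have "\<mu> \<in> point_spectrum Op \<longleftrightarrow> \<mu> \<in> insert 0 (c ` insert u U)" for \<mu>
    using zero_eigenvalue by (cases "\<mu> = 0") (simp_all only: insert_iff simp_thms)
  then show ?thesis by (rule set_eqI)
qed

subsection \<open>Spectrum\<close>

text \<open>If the resolvent at \<open>\<mu>\<close> is bounded by \<open>C\<close>, applying it to an eigenvector for \<open>\<nu>\<close> gives
  \<open>1 \<le> C * dist \<nu> \<mu>\<close>, so no eigenvalues accumulate at \<open>\<mu>\<close>.\<close>

lemma resolvent_set_away_from_point_spectrum:
  assumes "\<mu> \<in> resolvent_set V Op"
  shows "\<mu> \<notin> closure (point_spectrum Op)"
proof -
  let ?G = "op_app (op_shift Op \<mu>)"
  obtain C where bij: "bij_betw ?G (op_dom Op) (ell2 V)"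
    and C: "\<And>g. g \<in> ell2 V \<Longrightarrow>
      ell2_norm V (the_inv_into (op_dom Op) ?G g) \<le> C * ell2_norm V g"
    using assms by (auto simp: resolvent_set_def)
  have far: "1 \<le> C * dist \<nu> \<mu>" if \<nu>: "\<nu> \<in> point_spectrum Op" for \<nu>
  proof -
    obtain f where f: "f \<in> op_dom Op" "act f = scaleF \<nu> f" "f \<noteq> 0"
      using \<nu> by (auto simp: point_spectrum_def eigenspace_def Op_app)
    have fV: "f \<in> ell2 V" using f(1) by (simp add: Op_dom)
    have Gf: "?G f = scaleF (\<nu> - \<mu>) f"
      by (auto simp: op_shift_def Op_app f(2) fun_eq_iff algebra_simps)
    have "the_inv_into (op_dom Op) ?G (?G f) = f"
      using bij f(1) by (intro the_inv_into_f_f) (auto simp: bij_betw_def)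
    then have "ell2_norm V f \<le> C * ell2_norm V (scaleF (\<nu> - \<mu>) f)"
      using C[of "?G f"] fV by (simp add: Gf ell2_scale)
    then have "1 * ell2_norm V f \<le> (C * dist \<nu> \<mu>) * ell2_norm V f"
      by (simp add: ell2_norm_scale dist_norm)
    moreover have "0 < ell2_norm V f"
      using f(3) ell2_norm_eq_0_iff[OF fV] ell2_norm_nonneg[of V f] by linarith
    ultimately show ?thesis by (simp only: mult_le_cancel_right_pos)
  qed
  show ?thesis
  proof
    assume "\<mu> \<in> closure (point_spectrum Op)"
    moreover have "0 < 1 / (\<bar>C\<bar> + 1)" by (simp add: add_nonneg_pos)
    ultimately obtain \<nu> where \<nu>: "\<nu> \<in> point_spectrum Op" "dist \<nu> \<mu> < 1 / (\<bar>C\<bar> + 1)"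
      unfolding closure_approachable by blast
    have "C * dist \<nu> \<mu> \<le> (\<bar>C\<bar> + 1) * dist \<nu> \<mu>" by (intro mult_right_mono) auto
    also have "\<dots> < 1"
      using \<nu>(2) by (simp add: pos_less_divide_eq mult.commute add_nonneg_pos)
    finally show False using far[OF \<nu>(1)] by simp
  qed
qed

text \<open>Away from the closure of the point spectrum the equation \<open>(Op - \<mu>) f = g\<close> is solved
  vertex by vertex, all vertices but \<open>u\<close> first; the value at \<open>u\<close> then follows from the finitely
  many values on \<open>A\<close>. The bound comes from the distance of \<open>\<mu>\<close> to the point spectrum.\<close>

lemma resolvent_setI:
  assumes "\<mu> \<notin> closure (point_spectrum Op)"
  shows "\<mu> \<in> resolvent_set V Op"
proof -
  obtain d where d: "d > 0" and far: "\<And>\<nu>. \<nu> \<in> point_spectrum Op \<Longrightarrow> d \<le> cmod (\<nu> - \<mu>)"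
    using assms unfolding closure_approachable dist_norm by (meson not_le)
  have far_U: "d \<le> cmod (c v - \<mu>)" if "v \<in> insert u U" for v
    using far that by (auto simp: point_spectrum_Op)
  have far_0: "d \<le> cmod \<mu>" using far[OF zero_eigenvalue] by simp
  have ne_U: "c v \<noteq> \<mu>" if "v \<in> insert u U" for v using far_U[OF that] d by auto
  have ne_0: "\<mu> \<noteq> 0" using far_0 d by auto
  let ?G = "op_app (op_shift Op \<mu>)"
  have G: "?G f = act f - scaleF \<mu> f" for f by (simp add: op_shift_def Op_app)
  \<comment> \<open>The entry \<open>0\<close> at \<open>u\<close> makes \<open>D g\<close> vanish there, so that \<open>s g\<close> is the value of \<open>R g\<close> at \<open>u\<close>.\<close>
  define m where "m v = (if v \<in> U then 1 / (c v - \<mu>) else if v = u then 0 else - 1 / \<mu>)" for v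
  define D where "D g v = m v * g v" for g :: "'v \<Rightarrow> complex" and v
  define s where "s g = (g u - (\<Sum>v\<in>A. c v * D g v)) / (c u - \<mu>)" for g
  define R where "R g = D g + scaleF (s g) (unit_fun u)" for g
  have Du: "D g u = 0" for g using u_notin_U by (simp add: D_def m_def)
  have m: "cmod (m v) \<le> 1 / d" for v
    using d far_0 far_U[of v] by (auto simp: m_def norm_divide intro!: divide_left_mono mult_pos_pos)
  have D_le: "cmod (D g v) \<le> 1 / d * cmod (g v)" for g v
    unfolding D_def norm_mult by (intro mult_right_mono m) simp
  have D_ell2: "D g \<in> ell2 V" and D_norm: "ell2_norm V (D g) \<le> 1 / d * ell2_norm V g"
    if g: "g \<in> ell2 V" for g
  proof -
    have off: "D g v = 0" if "v \<notin> V" for v by (simp add: D_def ell2_vanish[OF g that])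
    show "D g \<in> ell2 V" by (rule ell2_dominated[OF g D_le off])
    show "ell2_norm V (D g) \<le> 1 / d * ell2_norm V g"
      using d by (intro ell2_norm_dominated[OF g D_le off]) simp_all
  qed
  have R_ell2: "R g \<in> ell2 V" if "g \<in> ell2 V" for g
    unfolding R_def by (intro ell2_add ell2_scale ell2_unit D_ell2 that u_V)
  have GR: "?G (R g) = g" for g
  proof
    fix w
    consider "w \<in> U" | "w = u" | "w \<notin> U" "w \<noteq> u" by blast
    then show "?G (R g) w = g w"
    proof cases
      case 1
      then have "w \<noteq> u" using u_notin_U by auto
      then have "?G (R g) w = ((c w - \<mu>) * m w) * g w"
        using 1 by (simp add: G R_def act_def D_def algebra_simps)
      also have "(c w - \<mu>) * m w = 1" using 1 ne_U[of w] by (simp add: m_def)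
      finally show ?thesis by simp
    next
      case 2
      have "(\<Sum>v\<in>A. c v * R g v) = (\<Sum>v\<in>A. c v * D g v) + (\<Sum>v\<in>A. if v = u then c u * s g else 0)"
        unfolding sum.distrib[symmetric] by (intro sum.cong) (auto simp: R_def algebra_simps)
      also have "(\<Sum>v\<in>A. if v = u then c u * s g else 0) = c u * s g"
        using fin_A u_A by simp
      finally have "?G (R g) u = (\<Sum>v\<in>A. c v * D g v) + (c u - \<mu>) * s g"
        using u_notin_U Du by (simp add: G act_def R_def[of g] algebra_simps)
      also have "(c u - \<mu>) * s g = g u - (\<Sum>v\<in>A. c v * D g v)"
        using ne_U[of u] by (simp add: s_def)
      finally show ?thesis using 2 by simp
    next
      case 3
      then show ?thesis using ne_0 by (simp add: G R_def act_def D_def m_def)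
    qed
  qed
  have R_dom: "R g \<in> op_dom Op" if "g \<in> ell2 V" for g
  proof -
    have "act (R g) = g + scaleF \<mu> (R g)" using GR[of g] by (auto simp: G fun_eq_iff algebra_simps)
    then show ?thesis using R_ell2[OF that] that by (simp add: Op_dom ell2_add ell2_scale)
  qed
  have inj: "inj_on ?G (op_dom Op)"
  proof (rule inj_onI)
    fix f g assume f: "f \<in> op_dom Op" and g: "g \<in> op_dom Op" and eq: "?G f = ?G g"
    have "act (f - g) = scaleF \<mu> (f - g)"
      unfolding act_diff using eq by (auto simp: G fun_eq_iff algebra_simps)
    then have "f - g \<in> eigenspace Op \<mu>"
      using f g by (simp add: eigenspace_def Op_dom Op_app ell2_diff ell2_scale)
    moreover have "\<mu> \<notin> point_spectrum Op" using assms closure_subset by blast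
    ultimately have "f - g = 0" by (auto simp: point_spectrum_def)
    then show "f = g" by simp
  qed
  have "?G ` op_dom Op = ell2 V"
  proof
    show "?G ` op_dom Op \<subseteq> ell2 V" by (auto simp: G Op_dom intro!: ell2_diff ell2_scale)
    show "ell2 V \<subseteq> ?G ` op_dom Op" by (metis GR R_dom imageI subsetI)
  qed
  then have bij: "bij_betw ?G (op_dom Op) (ell2 V)" using inj by (simp add: bij_betw_def)
  define C where "C = 1 / d + (1 + (\<Sum>v\<in>A. cmod (c v)) / d) / d"
  have "ell2_norm V (the_inv_into (op_dom Op) ?G g) \<le> C * ell2_norm V g" if g: "g \<in> ell2 V" for g
  proof -
    let ?n = "ell2_norm V g"
    have "cmod (\<Sum>v\<in>A. c v * D g v) \<le> (\<Sum>v\<in>A. cmod (c v) * (1 / d * ?n))"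
    proof (rule sum_norm_le)
      fix v
      have "cmod (D g v) \<le> 1 / d * ?n"
        using D_norm[OF g] cmod_le_ell2_norm[OF D_ell2[OF g], of v] by linarith
      then show "cmod (c v * D g v) \<le> cmod (c v) * (1 / d * ?n)"
        unfolding norm_mult by (rule mult_left_mono) simp
    qed
    also have "\<dots> = (\<Sum>v\<in>A. cmod (c v)) / d * ?n"
      unfolding sum_distrib_right[symmetric] by simp
    finally have "cmod (g u - (\<Sum>v\<in>A. c v * D g v)) \<le> ?n + (\<Sum>v\<in>A. cmod (c v)) / d * ?n"
      using cmod_le_ell2_norm[OF g, of u] norm_triangle_ineq4[of "g u" "\<Sum>v\<in>A. c v * D g v"]
      by linarith
    also have "\<dots> = (1 + (\<Sum>v\<in>A. cmod (c v)) / d) * ?n" by (simp only: distrib_right mult_1)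
    finally have le: "cmod (g u - (\<Sum>v\<in>A. c v * D g v))
        \<le> (1 + (\<Sum>v\<in>A. cmod (c v)) / d) * ?n" .
    have "cmod (s g) \<le> (1 + (\<Sum>v\<in>A. cmod (c v)) / d) * ?n / d"
      unfolding s_def norm_divide using d far_U[of u]
      by (intro frac_le le order_trans[OF norm_ge_zero le]) auto
    then have "ell2_norm V (R g) \<le> 1 / d * ?n + (1 + (\<Sum>v\<in>A. cmod (c v)) / d) * ?n / d"
      using ell2_norm_triangle[OF D_ell2[OF g] ell2_scale[OF ell2_unit[OF u_V]], of "s g"] D_norm[OF g]
      by (simp add: R_def ell2_norm_scale ell2_norm_unit u_V)
    also have "\<dots> = C * ?n" by (simp add: C_def algebra_simps)
    also have "R g = the_inv_into (op_dom Op) ?G g"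
      using the_inv_into_f_eq[OF inj GR R_dom[OF g]] by simp
    finally show ?thesis .
  qed
  then show ?thesis using bij unfolding resolvent_set_def by blast
qed

lemma spectrum_Op: "spectrum V Op = closure (point_spectrum Op)"
  using resolvent_set_away_from_point_spectrum resolvent_setI by (auto simp: spectrum_def)

subsection \<open>Multiplicities\<close>

lemma multiplicity_nonzero:
  assumes "\<mu> \<noteq> 0"
  shows "multiplicity_fun V Op \<mu> =o |level \<mu>|"
  unfolding multiplicity_fun_def eigenspace_nonzero[OF assms]
  by (rule ordIso_transitive[OF hilbert_dim_eq[OF countable_V
        unit_orthonormal_basis[OF level_V]] card_unit_funs])

text \<open>The kernel is the hyperplane of \<open>\<ell>\<^sup>2(null_verts)\<close> orthogonal to \<open>wvec\<close>, or the whole space when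
  \<open>wvec = 0\<close>. So its dimension is that of \<open>null_verts\<close> with at most one vertex removed.\<close>

lemma multiplicity_zero:
  obtains T where "null_verts - {u} \<subseteq> T" "T \<subseteq> null_verts" "multiplicity_fun V Op 0 =o |T|"
proof (cases "wvec = 0")
  case True
  have "orth_diff V (ell2 null_verts) {wvec} = ell2 null_verts"
    by (simp add: True orth_diff_def)
  then have "multiplicity_fun V Op 0 =o |unit_fun ` null_verts|"
    unfolding multiplicity_fun_def eigenspace_zero
    using hilbert_dim_eq[OF countable_V unit_orthonormal_basis[OF null_verts_V]] by simp
  then have "multiplicity_fun V Op 0 =o |null_verts|"
    by (rule ordIso_transitive[OF _ card_unit_funs])
  then show ?thesis using that[of null_verts] by blast
next
  case False
  obtain B where B: "orthonormal_basis V (orth_diff V (ell2 null_verts) {wvec}) B"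
    "|B| =o |null_verts - {u}|"
    using orth_vector_orthonormal_basis[OF null_verts_V wvec_ell2[OF A_null_verts] False, of u]
      u_A A_null_verts by blast
  have "multiplicity_fun V Op 0 =o |null_verts - {u}|"
    unfolding multiplicity_fun_def eigenspace_zero
    by (rule ordIso_transitive[OF hilbert_dim_eq[OF countable_V B(1)] B(2)])
  then show ?thesis using that[of "null_verts - {u}"] by blast
qed

lemma multiplicity_countable: "multiplicity_fun V Op \<mu> \<le>o natLeq"
proof -
  obtain T where "T \<subseteq> V" "multiplicity_fun V Op \<mu> =o |T|"
  proof (cases "\<mu> = 0")
    case True
    obtain T where "null_verts - {u} \<subseteq> T" "T \<subseteq> null_verts" "multiplicity_fun V Op 0 =o |T|"
      by (rule multiplicity_zero)
    then show ?thesis using that[of T] True null_verts_V by blast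
  next
    case False
    then show ?thesis using that[OF level_V] multiplicity_nonzero by blast
  qed
  moreover from this have "|T| \<le>o natLeq"
    using countable_subset[OF _ countable_V] by (simp only: countable_card_le_natLeq)
  ultimately show ?thesis by (simp only: ordIso_ordLeq_trans)
qed

lemma multiplicity_zero_infinite:
  assumes "infinite (V - U)"
  shows "multiplicity_fun V Op 0 =o natLeq"
proof -
  obtain T where T: "null_verts - {u} \<subseteq> T" "T \<subseteq> null_verts" "multiplicity_fun V Op 0 =o |T|"
    by (rule multiplicity_zero)
  have "infinite (V - U - {u})" using assms by simp
  moreover have "V - U - {u} \<subseteq> T" using T(1) by (auto simp: null_verts_def)
  ultimately have "infinite T" using finite_subset by blast
  then have "natLeq \<le>o |T|" using infinite_iff_natLeq_ordLeq[of T] by simp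
  then have "natLeq \<le>o multiplicity_fun V Op 0"
    by (rule ordLeq_ordIso_trans[OF _ ordIso_symmetric[OF T(3)]])
  then show ?thesis by (rule ordIso_iff_ordLeq[THEN iffD2, OF conjI[OF multiplicity_countable]])
qed

subsection \<open>Rootspaces\<close>

lemma op_app_power: "op_app (op_power V T k) f = (op_app T ^^ k) f"
  by (induction k arbitrary: f) (simp_all add: funpow_swap1)

lemma op_dom_power: "k > 0 \<Longrightarrow> f \<in> op_dom (op_power V T k) \<Longrightarrow> f \<in> op_dom T"
  by (cases k) auto

lemma shift_0: "op_app (op_shift Op 0) = act"
  by (auto simp: op_shift_def Op_app fun_eq_iff)

text \<open>Powers of the shifted operator act as powers of a scalar at every vertex but \<open>u\<close>, and also at
  \<open>u\<close> for functions vanishing on the rest of \<open>A\<close>. Hence a generalized eigenvector satisfies the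
  same pointwise conditions as an eigenvector wherever the rank one part is not visible.\<close>

lemma shift_power_off:
  assumes "v \<notin> insert u U"
  shows "(op_app (op_shift Op \<mu>) ^^ k) f v = (- \<mu>) ^ k * f v"
  using assms by (induction k) (auto simp: op_shift_def Op_app act_def)

lemma shift_power_U:
  assumes "v \<in> U"
  shows "(op_app (op_shift Op \<mu>) ^^ k) f v = (c v - \<mu>) ^ k * f v"
  using assms by (induction k) (auto simp: op_shift_def Op_app act_def algebra_simps)

lemma shift_power_u:
  assumes "\<And>v. v \<in> A \<Longrightarrow> v \<noteq> u \<Longrightarrow> f v = 0"
  shows "(op_app (op_shift Op \<mu>) ^^ k) f u = (c u - \<mu>) ^ k * f u"
proof (induction k)
  case (Suc k)
  let ?g = "(op_app (op_shift Op \<mu>) ^^ k) f"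
  have "?g v = 0" if "v \<in> A" "v \<noteq> u" for v
    using that disj assms by (subst shift_power_off) auto
  then have "act ?g u = c u * ?g u" by (rule act_u_single)
  moreover have "(op_app (op_shift Op \<mu>) ^^ Suc k) f u = act ?g u - \<mu> * ?g u"
    by (simp add: op_shift_def Op_app)
  ultimately show ?case using Suc by (simp add: algebra_simps)
qed simp

lemma eigenvector_generalized:
  assumes "f \<in> eigenspace Op \<mu>" "f \<noteq> 0"
  shows "f \<in> generalized_eigenvectors V Op \<mu>"
proof -
  have "f \<in> op_dom (op_power V Op 1)" "op_app (op_power V (op_shift Op \<mu>) 1) f = 0"
    using assms(1) by (auto simp: eigenspace_def op_shift_def Op_dom Op_app)
  then show ?thesis using assms(2) unfolding generalized_eigenvectors_def
    by (auto intro!: exI[of _ 1])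
qed

lemma generalized_eigenvectorE:
  assumes "f \<in> generalized_eigenvectors V Op \<mu>"
  obtains k where "k > 0" "f \<in> ell2 V" "f \<noteq> 0" "(op_app (op_shift Op \<mu>) ^^ k) f = 0"
  using assms op_dom_power[of _ f Op]
  by (auto simp: generalized_eigenvectors_def op_app_power Op_dom)

text \<open>For \<open>\<mu> \<noteq> 0\<close> a generalized eigenvector vanishes off \<open>insert u U\<close>, so the rank one part acts on
  it as the scalar \<open>c u\<close> and the power can be cancelled at each vertex.\<close>

lemma generalized_eigenvectors_nonzero:
  assumes "\<mu> \<noteq> 0"
  shows "generalized_eigenvectors V Op \<mu> = eigenspace Op \<mu> - {0}"
proof (intro equalityI subsetI)
  fix f assume "f \<in> generalized_eigenvectors V Op \<mu>"
  then obtain k where k: "k > 0" "f \<in> ell2 V" "f \<noteq> 0"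
    and *: "(op_app (op_shift Op \<mu>) ^^ k) f = 0"
    by (rule generalized_eigenvectorE)
  have off: "f v = 0" if "v \<notin> insert u U" for v
    using shift_power_off[OF that, of k \<mu> f] * assms by simp
  have "c u = \<mu> \<or> f u = 0"
    using shift_power_u[of f k \<mu>] off disj * k by auto
  moreover have "c v = \<mu> \<or> f v = 0" if "v \<in> U" for v
    using shift_power_U[OF that, of k \<mu> f] * k by auto
  ultimately have "f v = 0" if "v \<notin> level \<mu>" for v
    using off[of v] that by (cases "v = u"; cases "v \<in> U") (auto simp: level_def)
  then show "f \<in> eigenspace Op \<mu> - {0}"
    using k by (simp add: eigenspace_nonzero[OF assms] ell2_subset_iff[OF level_V])
qed (use eigenvector_generalized in auto)

lemma generalized_eigenvector_zero_null_verts: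
  assumes "f \<in> generalized_eigenvectors V Op 0"
  shows "f \<in> ell2 null_verts"
proof -
  obtain k where k: "k > 0" "f \<in> ell2 V" "f \<noteq> 0"
    and *: "(op_app (op_shift Op 0) ^^ k) f = 0"
    using assms by (rule generalized_eigenvectorE)
  have "c v = 0 \<or> f v = 0" if "v \<in> U" for v
    using shift_power_U[OF that, of k 0 f] * k by auto
  then show ?thesis using k by (simp add: ell2_null_verts_iff)
qed

text \<open>If \<open>c u\<close> is not \<open>0\<close>, the image of \<open>f\<close> under the \<open>k\<close>-th power of the operator has the
  value \<open>(c u)\<^bsup>k - 1\<^esup> \<langle>f, wvec\<rangle>\<close> at \<open>u\<close>, so all powers have the same kernel.\<close>

lemma generalized_eigenvectors_zero:
  assumes "c u \<noteq> 0"
  shows "generalized_eigenvectors V Op 0 = eigenspace Op 0 - {0}"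
proof (intro equalityI subsetI)
  fix f assume f: "f \<in> generalized_eigenvectors V Op 0"
  let ?G = "op_app (op_shift Op 0)"
  obtain k where k: "k > 0" "f \<noteq> 0" and *: "(?G ^^ k) f = 0"
    using f by (rule generalized_eigenvectorE)
  then obtain j where "k = Suc j" using gr0_implies_Suc by blast
  then have "(?G ^^ j) (?G f) = 0" using * by (simp add: funpow_swap1)
  moreover have G: "?G f = act f" by (simp only: shift_0)
  moreover have "act f v = 0" if "v \<in> A" "v \<noteq> u" for v
    using that disj by (auto simp: act_def)
  ultimately have "(c u - 0) ^ j * act f u = 0"
    using shift_power_u[of "act f" j 0] by (simp del: power_eq_0_iff)
  then have "ell2_inner V f wvec = 0" using assms by (simp add: act_u)
  then show "f \<in> eigenspace Op 0 - {0}"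
    using generalized_eigenvector_zero_null_verts[OF f] k
    by (simp add: eigenspace_zero orth_diff_def)
qed (use eigenvector_generalized in auto)

text \<open>If \<open>c u = 0\<close>, the rank one part is nilpotent of order two and everything off the non-zero
  diagonal entries is annihilated by the square.\<close>

lemma generalized_eigenvectors_zero_nilpotent:
  assumes "c u = 0"
  shows "generalized_eigenvectors V Op 0 = ell2 null_verts - {0}"
proof (intro equalityI subsetI)
  fix f assume f: "f \<in> generalized_eigenvectors V Op 0"
  then show "f \<in> ell2 null_verts - {0}"
    using generalized_eigenvector_zero_null_verts[OF f]
    by (auto simp: generalized_eigenvectors_def)
next
  fix f assume f: "f \<in> ell2 null_verts - {0}"
  then have fV: "f \<in> ell2 V" and fU: "\<And>v. v \<in> U \<Longrightarrow> c v = 0 \<or> f v = 0"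
    by (auto simp: ell2_null_verts_iff)
  have act_f: "act f v = 0" if "v \<noteq> u" for v
    using that fU by (auto simp: act_def)
  then have "act f \<in> ell2 V"
    using u_V by (intro ell2_finite_support[of "{u}"]) auto
  moreover have act_act: "act (act f) = 0"
  proof
    fix w show "act (act f) w = 0 w"
      using act_u_single[of "act f"] act_f u_notin_U assms
      by (cases "w = u") (auto simp: act_def[of "act f"])
  qed
  moreover have "op_app (op_power V (op_shift Op 0) 2) f = act (act f)"
    by (simp only: op_app_power shift_0 numeral_2_eq_2 funpow.simps o_apply id_apply)
  moreover have "f \<in> op_dom (op_power V Op 2) \<longleftrightarrow> f \<in> op_dom Op \<and> act f \<in> op_dom Op \<and> act (act f) \<in> ell2 V"
    by (auto simp: numeral_2_eq_2 Op_app)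
  ultimately have "f \<in> op_dom (op_power V Op 2)" "op_app (op_power V (op_shift Op 0) 2) f = 0"
    using fV by (simp_all add: Op_dom)
  then show "f \<in> generalized_eigenvectors V Op 0"
    using f unfolding generalized_eigenvectors_def by (auto intro!: exI[of _ 2])
qed

lemma rootspace_nonzero:
  assumes "\<mu> \<noteq> 0"
  shows "rootspace V Op \<mu> = eigenspace Op \<mu>"
  unfolding rootspace_def generalized_eigenvectors_nonzero[OF assms] eigenspace_nonzero[OF assms]
    ell2_eq_orth_compl[OF level_V]
  by (rule orth_compl_closed_cspan) (auto intro: ell2_unit)

lemma eigenspace_zero_orth_compl:
  "eigenspace Op 0 = orth_compl V (insert wvec (unit_fun ` (V - null_verts)))"
  unfolding eigenspace_zero ell2_eq_orth_compl[OF null_verts_V] by (auto simp: orth_diff_def)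

lemma rootspace_zero:
  assumes "c u \<noteq> 0"
  shows "rootspace V Op 0 = eigenspace Op 0"
  unfolding rootspace_def generalized_eigenvectors_zero[OF assms] eigenspace_zero_orth_compl
  using wvec_ell2[OF A_V] by (intro orth_compl_closed_cspan) (auto intro: ell2_unit)

lemma rootspace_zero_nilpotent:
  assumes "c u = 0"
  shows "rootspace V Op 0 = ell2 null_verts"
  unfolding rootspace_def generalized_eigenvectors_zero_nilpotent[OF assms]
    ell2_eq_orth_compl[OF null_verts_V]
  by (rule orth_compl_closed_cspan) (auto intro: ell2_unit)

end

section \<open>Joins in a rooted directed tree\<close>

text \<open>A directed path between vertices avoids \<open>\<infinity>\<close> because \<open>\<infinity>\<close> has no child.\<close>

lemma ext_edges_rtrancl_Some:
  "(Some x, Some y) \<in> (ext_edges V E)\<^sup>* \<longleftrightarrow> (x, y) \<in> E\<^sup>*"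
proof
  have "\<forall>z. b = Some z \<longrightarrow> (x, z) \<in> E\<^sup>*" if "(Some x, b) \<in> (ext_edges V E)\<^sup>*" for b
    using that
  proof (induction rule: rtrancl_induct)
    case (step a b)
    then show ?case by (auto simp: ext_edges_def intro: rtrancl_into_rtrancl)
  qed simp
  then show "(x, y) \<in> E\<^sup>*" if "(Some x, Some y) \<in> (ext_edges V E)\<^sup>*" using that by blast
  show "(Some x, Some y) \<in> (ext_edges V E)\<^sup>*" if "(x, y) \<in> E\<^sup>*"
    using that
  proof (induction rule: rtrancl_induct)
    case (step a b)
    then have "(Some a, Some b) \<in> ext_edges V E" by (auto simp: ext_edges_def)
    with step show ?case by (meson rtrancl.rtrancl_into_rtrancl)
  qed simp
qed

lemma join_Some:
  "join V E (Some x) (Some y)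
    = (if (y, x) \<in> E\<^sup>* then Some x else if (x, y) \<in> E\<^sup>* then Some y else None)"
  by (simp add: join_def Des_def ext_edges_rtrancl_Some)

lemma Asc_iff: "w \<in> Asc E u \<longleftrightarrow> (w, u) \<in> E\<^sup>+"
  by (auto simp: Asc_def trancl_power Suc_le_eq)

context rooted_directed_tree
begin

lemma root_in_V: "rt \<in> V" and root_no_parent: "(x, rt) \<notin> E"
  using unique_root by auto

lemma rtrancl_antisym: "(x, y) \<in> E\<^sup>* \<Longrightarrow> (y, x) \<in> E\<^sup>* \<Longrightarrow> x = y"
  using acyclic_impl_antisym_rtrancl[OF no_circuits] by (auto dest: antisymD)

lemma rtrancl_in_V:
  assumes "(x, y) \<in> E\<^sup>*"
  shows "x \<in> V \<longleftrightarrow> y \<in> V"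
  using assms by (induction rule: rtrancl_induct) (use edges_in_verts in auto)

lemma rtrancl_parent:
  assumes "(x, z) \<in> E\<^sup>*" "x \<noteq> z" "(y, z) \<in> E"
  shows "(x, y) \<in> E\<^sup>*"
  using assms by (cases rule: rtranclE) (auto dest: parent_unique)

lemma ancestors_comparable:
  assumes "(x, z) \<in> E\<^sup>*" "(y, z) \<in> E\<^sup>*"
  shows "(x, y) \<in> E\<^sup>* \<or> (y, x) \<in> E\<^sup>*"
  using assms
proof (induction rule: rtrancl_induct)
  case (step z z')
  then show ?case
    by (metis rtrancl.rtrancl_into_rtrancl rtrancl_parent)
qed simp

lemma Asc_iff_strict: "w \<in> Asc E v \<longleftrightarrow> (w, v) \<in> E\<^sup>* \<and> w \<noteq> v"
  unfolding Asc_iff using no_circuits by (auto simp: acyclic_def rtrancl_eq_or_trancl)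

text \<open>Along an undirected path from the root, a step to a child extends the directed path from the
  root, and a step to the parent shortens it, since the last vertex is then not the root.\<close>

lemma root_reaches:
  assumes "v \<in> V"
  shows "(rt, v) \<in> E\<^sup>*"
  using connected_undirected[OF root_in_V assms]
proof (induction rule: rtrancl_induct)
  case (step y z)
  from step.hyps(2) show ?case
  proof
    assume "(y, z) \<in> E"
    then show ?thesis using step.IH by (rule rtrancl_into_rtrancl[rotated])
  next
    assume "(y, z) \<in> E\<inverse>"
    then have zy: "(z, y) \<in> E" by simp
    then have "rt \<noteq> y" using root_no_parent by auto
    then show ?thesis using rtrancl_parent[OF step.IH _ zy] by simp
  qed
qed simp

lemma finite_ancestors:
  assumes "v \<in> V"
  shows "finite {w. (w, v) \<in> E\<^sup>*}"
  using root_reaches[OF assms]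
proof (induction rule: rtrancl_induct)
  case base
  have "{w. (w, rt) \<in> E\<^sup>*} \<subseteq> {rt}" using root_no_parent by (auto elim: rtranclE)
  then show ?case using finite_subset by blast
next
  case (step y z)
  have "{w. (w, z) \<in> E\<^sup>*} \<subseteq> insert z {w. (w, y) \<in> E\<^sup>*}"
    using rtrancl_parent[OF _ _ step.hyps(2)] by auto
  then show ?case using step.IH finite_subset by blast
qed

lemma relpow_root_unique:
  assumes "(rt, v) \<in> E ^^ n" "(rt, v) \<in> E ^^ m"
  shows "n = m"
  using assms
proof (induction n arbitrary: m v)
  case 0
  then show ?case using root_no_parent by (cases m) auto
next
  case (Suc n)
  then obtain y where y: "(rt, y) \<in> E ^^ n" "(y, v) \<in> E" by auto
  obtain k where k: "m = Suc k" using Suc.prems(2) y(2) root_no_parent by (cases m) auto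
  then obtain y' where "(rt, y') \<in> E ^^ k" "(y', v) \<in> E" using Suc.prems(2) by auto
  then show ?case using Suc.IH[OF y(1)] parent_unique[OF y(2)] k by auto
qed

lemma depth_eq: "(rt, v) \<in> E ^^ n \<Longrightarrow> depth E rt v = n"
  unfolding depth_def using relpow_root_unique by (intro the_equality) auto

lemma depth_edge:
  assumes "(x, y) \<in> E"
  shows "depth E rt y = Suc (depth E rt x)"
proof -
  have "(rt, x) \<in> E\<^sup>*" using assms edges_in_verts by (intro root_reaches) auto
  then obtain n where n: "(rt, x) \<in> E ^^ n" using rtrancl_imp_relpow by blast
  then have "(rt, y) \<in> E ^^ Suc n" using assms by auto
  then show ?thesis using n depth_eq by simp
qed

lemma depth_strict: "(x, y) \<in> E\<^sup>+ \<Longrightarrow> depth E rt x < depth E rt y"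
  by (induction rule: trancl_induct) (auto simp: depth_edge)

text \<open>The upper one of two comparable vertices is itself a common ancestor, the others lie above it, and the depth
  increases strictly along directed paths.\<close>

lemma meet_comparable:
  assumes "(v, u) \<in> E\<^sup>*" "u \<in> V"
  shows "meet V E rt u v = v" "meet V E rt v u = v"
proof -
  have v: "v \<in> V" using assms rtrancl_in_V by blast
  have common: "(\<exists>m n. (w, x) \<in> E ^^ n \<and> (w, y) \<in> E ^^ m) \<longleftrightarrow> (w, x) \<in> E\<^sup>* \<and> (w, y) \<in> E\<^sup>*"
    for w x y by (auto simp: rtrancl_power)
  have top: "arg_max (depth E rt) P = v" if P: "\<And>w. P w \<longleftrightarrow> w \<in> V \<and> (w, u) \<in> E\<^sup>* \<and> (w, v) \<in> E\<^sup>*" for P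
  proof (rule arg_maxI[where P = P and f = "depth E rt"])
    show "P v" using v assms by (simp add: P)
    have less: "w = v \<or> depth E rt w < depth E rt v" if "P w" for w
      using that depth_strict[of w v] by (auto simp: P rtrancl_eq_or_trancl)
    show "\<not> depth E rt v < depth E rt w" if "P w" for w using less[OF that] by auto
    show "w = v" if "P w" "\<forall>y. P y \<longrightarrow> \<not> depth E rt w < depth E rt y" for w
      using less[OF that(1)] that(2) \<open>P v\<close> by auto
  qed
  show "meet V E rt u v = v" "meet V E rt v u = v"
    unfolding meet_def common by (auto intro!: top)
qed

lemma path_cc_self: "path_cc E u u = {u}"
  by (auto simp: path_cc_def dest: rtrancl_antisym)

text \<open>If \<open>b\<close> is a descendant of \<open>u\<close>, then \<open>u\<close> is an ancestor of \<open>b\<close>; an ancestor \<open>v\<close> of \<open>b\<close> is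
  comparable with \<open>u\<close> and the join is their meet: \<open>v\<close> itself above \<open>u\<close>, and \<open>u\<close> on the path from \<open>u\<close>
  to \<open>b\<close>. In all other cases the join is the ordinary one, apart from \<open>b\<close> acting as a neutral
  element. So a vertex \<open>v\<close> joins to itself, to \<open>u\<close>, or to \<open>\<infinity>\<close>.\<close>

lemma join_at_eq:
  assumes u: "u \<in> V" and b: "b \<in> V" "b \<noteq> u" and v: "v \<in> V"
  shows "join_at V E rt b (Some u) (Some v)
    = (if v \<in> diag_verts E u b then Some v else if v \<in> rank_one_verts E u b then Some u else None)"
proof (cases "(u, b) \<in> E\<^sup>*")
  case ub: True
  have U: "v \<in> diag_verts E u b \<longleftrightarrow>
      (v, u) \<in> E\<^sup>* \<and> v \<noteq> u \<or> (u, v) \<in> E\<^sup>* \<and> (v, b) \<notin> E\<^sup>*" for v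
    using ub by (auto simp: diag_verts_def Des_def Des_open_def path_cc_def Asc_iff_strict)
  have A: "v \<in> rank_one_verts E u b \<longleftrightarrow> (u, v) \<in> E\<^sup>* \<and> (v, b) \<in> E\<^sup>*" for v
    using ub by (simp add: rank_one_verts_def Des_def path_cc_def)
  have uAsc: "u \<in> Asc E b" using ub b by (auto simp: Asc_iff_strict)
  consider (below) "(v, b) \<in> E\<^sup>*" "v \<noteq> b" | (b) "v = b" | (off) "(v, b) \<notin> E\<^sup>*" by blast
  then show ?thesis
  proof cases
    case below
    then have J: "join_at V E rt b (Some u) (Some v) = Some (meet V E rt u v)"
      using uAsc by (simp add: join_at_def Asc_iff_strict)
    from ancestors_comparable[OF below(1) ub] show ?thesis
    proof
      assume vu: "(v, u) \<in> E\<^sup>*"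
      then show ?thesis
        using meet_comparable(1)[OF vu u] ub below(1) unfolding J U A by (cases "v = u") auto
    next
      assume uv: "(u, v) \<in> E\<^sup>*"
      then show ?thesis
        using meet_comparable(2)[OF uv v] below(1) rtrancl_antisym[of u v] unfolding J U A by auto
    qed
  next
    case b: b
    then show ?thesis
      using ub rtrancl_antisym[of b u] unfolding U A b by (auto simp: join_at_def Asc_iff_strict)
  next
    case off
    then have "v \<noteq> b" "(v, u) \<notin> E\<^sup>*" using ub by (auto dest: rtrancl_trans)
    then show ?thesis using off b unfolding U A
      by (auto simp: join_at_def Asc_iff_strict join_Some)
  qed
next
  case ub: False
  have U: "v \<in> diag_verts E u b \<longleftrightarrow> (u, v) \<in> E\<^sup>* \<and> v \<noteq> u" for v
    using ub by (auto simp: diag_verts_def Des_def Des_open_def path_cc_self)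
  have A: "v \<in> rank_one_verts E u b \<longleftrightarrow> (v, u) \<in> E\<^sup>* \<or> v = b" for v
    using ub by (auto simp: rank_one_verts_def Des_def Asc_iff_strict)
  show ?thesis
    using ub b(2) rtrancl_antisym[of u v] unfolding U A
    by (auto simp: join_at_def Asc_iff_strict join_Some)
qed

lemma diag_rank_one_tree:
  assumes "countable V" and u: "u \<in> V" and b: "b \<in> V" "b \<noteq> u"
  shows "diag_rank_one V (diag_verts E u b) (rank_one_verts E u b) u"
proof
  let ?U = "diag_verts E u b" and ?A = "rank_one_verts E u b"
  show "countable V" by fact
  show "?U \<subseteq> V"
    using u rtrancl_in_V by (auto simp: diag_verts_def Des_def Des_open_def Asc_iff_strict)
  show "?A \<subseteq> V"
    using u b rtrancl_in_V by (auto simp: rank_one_verts_def path_cc_def Asc_iff_strict)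
  show "finite ?A"
    by (rule finite_subset[of _ "insert b ({w. (w, u) \<in> E\<^sup>*} \<union> {w. (w, b) \<in> E\<^sup>*})"])
      (auto simp: rank_one_verts_def path_cc_def Asc_iff_strict finite_ancestors u b)
  show "?A \<inter> ?U = {}"
    by (auto simp: rank_one_verts_def diag_verts_def path_cc_def Des_open_def Des_def
        Asc_iff_strict path_cc_self dest: rtrancl_antisym)
  show "u \<in> ?A" by (auto simp: rank_one_verts_def path_cc_def Des_def)
  have "b \<in> ?A" by (auto simp: rank_one_verts_def path_cc_def Des_def)
  then show "\<exists>b\<in>?A. b \<noteq> u" using b(2) by blast
qed

text \<open>A deepest descendant would be a leaf.\<close>

lemma infinite_Des:
  assumes "leafless V E" "v \<in> V"
  shows "infinite (Des E v)"
proof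
  assume fin: "finite (Des E v)"
  have "v \<in> Des E v" by (simp add: Des_def)
  then have "Max (depth E rt ` Des E v) \<in> depth E rt ` Des E v"
    using fin by (intro Max_in) auto
  then obtain w where w: "w \<in> Des E v" "depth E rt w = Max (depth E rt ` Des E v)" by auto
  have "w \<in> V" using w(1) assms(2) rtrancl_in_V[of v w] by (simp add: Des_def)
  then obtain x where x: "(w, x) \<in> E" using assms(1) by (auto simp: leafless_def)
  then have "x \<in> Des E v" using w(1) by (auto simp: Des_def intro: rtrancl_into_rtrancl)
  then have "depth E rt x \<le> depth E rt w" unfolding w(2) using fin by (intro Max_ge) auto
  then show False using depth_edge[OF x] by simp
qed

text \<open>Two children of one vertex are incomparable, so they are not both on the path to \<open>u\<close>.\<close>

lemma child_off_path:
  assumes "branching_vertex E w"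
  obtains x where "(w, x) \<in> E" "(x, u) \<notin> E\<^sup>*"
proof -
  obtain x y where xy: "x \<noteq> y" "(w, x) \<in> E" "(w, y) \<in> E"
    using assms by (auto simp: branching_vertex_def)
  have no: "(x', y') \<notin> E\<^sup>*" if "(w, x') \<in> E" "(w, y') \<in> E" "x' \<noteq> y'" for x' y'
  proof
    assume "(x', y') \<in> E\<^sup>*"
    then have "(x', w) \<in> E\<^sup>*" using rtrancl_parent that by blast
    then have "(w, w) \<in> E\<^sup>+" using that(1) by (meson rtrancl_into_trancl2)
    then show False using no_circuits by (simp add: acyclic_def)
  qed
  have "\<not> ((x, u) \<in> E\<^sup>* \<and> (y, u) \<in> E\<^sup>*)"
    using ancestors_comparable[of x u y] no[of x y] no[of y x] xy by auto
  then show ?thesis using that xy by blast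
qed

text \<open>Take a child of \<open>w\<close> that does not lead to \<open>u\<close>. Its descendants are incomparable with \<open>u\<close>, and
  there are infinitely many of them because the tree has no leaves.\<close>

lemma infinite_complement:
  assumes "leafless V E" "u \<in> V" "w \<in> Asc E u" "branching_vertex E w"
  shows "infinite (V - (Asc E u \<union> Des E u))"
proof -
  obtain x where x: "(w, x) \<in> E" "(x, u) \<notin> E\<^sup>*" using child_off_path[OF assms(4)] by blast
  have xV: "x \<in> V" using x(1) edges_in_verts by auto
  have wu: "(w, u) \<in> E\<^sup>*" "w \<noteq> u" using assms(3) by (auto simp: Asc_iff_strict)
  have "Des E x \<subseteq> V - (Asc E u \<union> Des E u)"
  proof
    fix y assume "y \<in> Des E x"
    then have xy: "(x, y) \<in> E\<^sup>*" by (simp add: Des_def)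
    have "(y, u) \<notin> E\<^sup>*" using x(2) xy by (meson rtrancl_trans)
    moreover have "(u, y) \<notin> E\<^sup>*"
    proof
      assume "(u, y) \<in> E\<^sup>*"
      then have "(u, x) \<in> E\<^sup>*" using ancestors_comparable[OF xy] x(2) by blast
      moreover have "u \<noteq> x" using x(2) by auto
      ultimately have "(u, w) \<in> E\<^sup>*" using rtrancl_parent x(1) by blast
      then show False using wu rtrancl_antisym by blast
    qed
    moreover have "y \<in> V" using xy xV rtrancl_in_V by blast
    ultimately show "y \<in> V - (Asc E u \<union> Des E u)" by (simp add: Asc_iff_strict Des_def)
  qed
  then show ?thesis using infinite_Des[OF assms(1) xV] finite_subset by blast
qed

lemma diag_verts_subset: "diag_verts E u b \<subseteq> Asc E u \<union> Des E u"
  by (auto simp: diag_verts_def Des_open_def)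

lemma insert_diag_verts:
  assumes "b \<noteq> u"
  shows "insert u (diag_verts E u b)
    = (if b \<in> Des_open E u u then Asc E u \<union> Des_closed E b u else Des E u)"
proof -
  have "b \<in> Des_open E u u \<longleftrightarrow> b \<in> Des E u"
    using assms by (auto simp: Des_open_def path_cc_self)
  then show ?thesis
    by (auto simp: diag_verts_def Des_def Des_open_def Des_closed_def path_oc_def path_cc_def
        dest: rtrancl_antisym)
qed

lemma weighted_join_map_eq:
  assumes "countable V" and u: "u \<in> V" and b: "b \<in> V" "b \<noteq> u"
  shows "weighted_join_map V E rt b u l
    = diag_rank_one.act (diag_verts E u b) (rank_one_verts E u b) u (\<lambda>v. l (Some v))"
proof (intro ext)
  fix f w
  interpret diag_rank_one V "diag_verts E u b" "rank_one_verts E u b" u "\<lambda>v. l (Some v)"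
    by (rule diag_rank_one_tree) fact+
  let ?U = "diag_verts E u b" and ?A = "rank_one_verts E u b"
  let ?S = "{v \<in> V. join_at V E rt b (Some u) (Some v) = Some w}"
  have "?S = (if w \<in> ?U then {w} else if w = u then ?A else {})"
    using U_V A_V disj u_notin_U
    by (auto simp: join_at_eq[OF u b] disjoint_iff split: if_splits)
  then show "weighted_join_map V E rt b u l f w = act f w"
    using fin_A by (simp add: weighted_join_map_def act_def)
qed

end

lemma weight_vector_eq:
  assumes "finite A"
  shows "weight_vector l A = (\<lambda>v. if v \<in> A then cnj (l (Some v)) else 0)"
proof
  fix w
  have "(\<Sum>v\<in>A. cnj (l (Some v)) * (if w = v then 1 else 0)) = (\<Sum>v\<in>A. if w = v then cnj (l (Some v)) else 0)"
    by (intro sum.cong) auto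
  then show "weight_vector l A w = (if w \<in> A then cnj (l (Some w)) else 0)"
    using assms by (simp add: weight_vector_def sum_fun_eval)
qed

theorem theorem4p23:
  fixes V :: "'v set" and E :: "('v \<times> 'v) set" and rt u b :: 'v
    and l :: "'v option \<Rightarrow> complex"
  assumes "rooted_directed_tree V E rt"
    and "countable V" and "infinite V"
    and "u \<in> V" and "b \<in> V - {u}"
    and "l None = 0"
  defines "W \<equiv> weighted_join_operator V E rt b u l"
    and "U \<equiv> diag_verts E u b"
    and "e \<equiv> weight_vector l (rank_one_verts E u b)"
    and "Wset \<equiv> \<lambda>\<mu>. {w \<in> diag_verts E u b. l (Some w) = \<mu>}"
  shows "
    (point_spectrum W =
       (if b \<in> Des_open E u u
        then {l (Some v) | v. v \<in> Asc E u \<union> Des_closed E b u} \<union> {0}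
        else {l (Some v) | v. v \<in> Des E u} \<union> {0})) \<and>
    (spectrum V W = closure (point_spectrum W)) \<and>
    (\<forall>\<mu>\<in>point_spectrum W.
       (\<mu> \<noteq> 0 \<and> \<mu> \<noteq> l (Some u) \<longrightarrow> eigenspace W \<mu> = ell2 (Wset \<mu>)) \<and>
       (\<mu> \<noteq> 0 \<and> \<mu> = l (Some u) \<longrightarrow>
          is_orth_sum V (eigenspace W \<mu>) (ell2 (Wset \<mu>)) (cspan {unit_fun u})) \<and>
       (\<mu> = 0 \<longrightarrow>
          is_orth_sum V (eigenspace W \<mu>) (ell2 (Wset 0))
            (orth_diff V (orth_diff V (ell2 V) (ell2 U)) (cspan {e})))) \<and>
    ((\<forall>\<mu>\<in>point_spectrum W.
          multiplicity_fun V W \<mu> \<le>o natLeq \<and>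
          (\<mu> \<noteq> 0 \<longrightarrow> multiplicity_fun V W \<mu> =o |{v \<in> {u} \<union> U. l (Some v) = \<mu>}| )) \<and>
       (leafless V E \<and> (\<exists>w\<in>Asc E u. branching_vertex E w) \<longrightarrow>
          multiplicity_fun V W 0 =o natLeq)) \<and>
    (\<forall>\<mu>\<in>generalized_eigenvalues V W.
       (\<mu> \<noteq> 0 \<longrightarrow> \<mu> \<in> point_spectrum W \<and> rootspace V W \<mu> = eigenspace W \<mu>) \<and>
       (\<mu> = 0 \<and> l (Some u) \<noteq> 0 \<longrightarrow> rootspace V W \<mu> = eigenspace W 0) \<and>
       (\<mu> = 0 \<and> l (Some u) = 0 \<longrightarrow>
          is_orth_sum V (rootspace V W \<mu>) (eigenspace W 0) (cspan {e})))"
proof -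
  interpret rooted_directed_tree V E rt by fact
  have u: "u \<in> V" and b: "b \<in> V" "b \<noteq> u" using assms by auto
  interpret diag_rank_one V U "rank_one_verts E u b" u "\<lambda>v. l (Some v)"
    unfolding U_def by (rule diag_rank_one_tree) fact+
  have "weighted_join_map V E rt b u l = act"
    unfolding U_def by (rule weighted_join_map_eq[OF assms(2) u b])
  then have W: "W = Op" by (simp only: W_def weighted_join_operator_def Op_def)
  have e: "e = wvec" unfolding e_def wvec_def by (rule weight_vector_eq[OF fin_A])
  have Wset: "Wset \<mu> = {w \<in> U. l (Some w) = \<mu>}" for \<mu> by (simp add: Wset_def U_def)
  have Wset_V: "Wset \<mu> \<subseteq> V" for \<mu> using U_V by (auto simp: Wset)
  have 1: "point_spectrum W =
       (if b \<in> Des_open E u u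
        then {l (Some v) | v. v \<in> Asc E u \<union> Des_closed E b u} \<union> {0}
        else {l (Some v) | v. v \<in> Des E u} \<union> {0})"
    unfolding W point_spectrum_Op unfolding U_def insert_diag_verts[OF b(2)] by auto
  have 2: "spectrum V W = closure (point_spectrum W)"
    unfolding W by (rule spectrum_Op)
  have 31: "eigenspace W \<mu> = ell2 (Wset \<mu>)" if "\<mu> \<noteq> 0" "\<mu> \<noteq> l (Some u)" for \<mu>
  proof -
    have "level \<mu> = Wset \<mu>" using that by (auto simp: level_def Wset)
    then show ?thesis using eigenspace_nonzero[OF that(1)] by (simp add: W)
  qed
  have 32: "is_orth_sum V (eigenspace W \<mu>) (ell2 (Wset \<mu>)) (cspan {unit_fun u})"
    if "\<mu> \<noteq> 0" "\<mu> = l (Some u)" for \<mu>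
  proof -
    have "level \<mu> = insert u (Wset \<mu>)" using that by (auto simp: level_def Wset)
    moreover have "u \<notin> Wset \<mu>" using u_notin_U by (simp add: Wset)
    ultimately show ?thesis
      using ell2_insert_orth_sum[OF Wset_V u] eigenspace_nonzero[OF that(1)] by (simp add: W)
  qed
  have 33: "is_orth_sum V (eigenspace W 0) (ell2 (Wset 0))
      (orth_diff V (orth_diff V (ell2 V) (ell2 U)) (cspan {e}))"
    unfolding W e orth_diff_ell2[OF U_V] orth_diff_cspan_singleton eigenspace_zero
      null_verts_Un Wset
    using U_V A_V disj by (intro orth_diff_vector_orth_sum wvec_ell2) auto
  have 4: "multiplicity_fun V W \<mu> =o |{v \<in> {u} \<union> U. l (Some v) = \<mu>}|" if "\<mu> \<noteq> 0" for \<mu>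
    using multiplicity_nonzero[OF that] by (simp add: W level_def)
  have 41: "multiplicity_fun V W 0 =o natLeq"
    if "leafless V E" "w \<in> Asc E u" "branching_vertex E w" for w
  proof -
    have "V - (Asc E u \<union> Des E u) \<subseteq> V - U" using diag_verts_subset by (auto simp: U_def)
    then have "infinite (V - U)" using infinite_complement[OF that(1) u that(2,3)] finite_subset by blast
    then show ?thesis unfolding W by (rule multiplicity_zero_infinite)
  qed
  have 51: "\<mu> \<in> point_spectrum W \<and> rootspace V W \<mu> = eigenspace W \<mu>"
    if "\<mu> \<in> generalized_eigenvalues V W" "\<mu> \<noteq> 0" for \<mu>
    using that generalized_eigenvectors_nonzero[OF that(2)] rootspace_nonzero[OF that(2)]
    unfolding W generalized_eigenvalues_def point_spectrum_def by blast
  have 52: "rootspace V W 0 = eigenspace W 0" if "l (Some u) \<noteq> 0"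
    unfolding W by (rule rootspace_zero[OF that])
  have 53: "is_orth_sum V (rootspace V W 0) (eigenspace W 0) (cspan {e})" if "l (Some u) = 0"
    unfolding W e rootspace_zero_nilpotent[OF that] eigenspace_zero
    by (intro orth_vector_orth_sum null_verts_V wvec_ell2 A_null_verts)
  show ?thesis
  proof (intro conjI)
    show "\<forall>\<mu>\<in>point_spectrum W.
       (\<mu> \<noteq> 0 \<and> \<mu> \<noteq> l (Some u) \<longrightarrow> eigenspace W \<mu> = ell2 (Wset \<mu>)) \<and>
       (\<mu> \<noteq> 0 \<and> \<mu> = l (Some u) \<longrightarrow>
          is_orth_sum V (eigenspace W \<mu>) (ell2 (Wset \<mu>)) (cspan {unit_fun u})) \<and>
       (\<mu> = 0 \<longrightarrow>
          is_orth_sum V (eigenspace W \<mu>) (ell2 (Wset 0))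
            (orth_diff V (orth_diff V (ell2 V) (ell2 U)) (cspan {e})))"
      using 31 32 33 by auto
    show "\<forall>\<mu>\<in>point_spectrum W.
          multiplicity_fun V W \<mu> \<le>o natLeq \<and>
          (\<mu> \<noteq> 0 \<longrightarrow> multiplicity_fun V W \<mu> =o |{v \<in> {u} \<union> U. l (Some v) = \<mu>}| )"
      using 4 multiplicity_countable unfolding W by simp
    show "leafless V E \<and> (\<exists>w\<in>Asc E u. branching_vertex E w) \<longrightarrow>
          multiplicity_fun V W 0 =o natLeq"
      using 41 by auto
    show "\<forall>\<mu>\<in>generalized_eigenvalues V W.
       (\<mu> \<noteq> 0 \<longrightarrow> \<mu> \<in> point_spectrum W \<and> rootspace V W \<mu> = eigenspace W \<mu>) \<and>
       (\<mu> = 0 \<and> l (Some u) \<noteq> 0 \<longrightarrow> rootspace V W \<mu> = eigenspace W 0) \<and>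
       (\<mu> = 0 \<and> l (Some u) = 0 \<longrightarrow>
          is_orth_sum V (rootspace V W \<mu>) (eigenspace W 0) (cspan {e}))"
      using 51 52 53 by auto
  qed (fact 1, fact 2)
qed

end
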